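(* For every $\ell\ge0$, with $d=\ell-k$ in the summand indexed by $k$, $$P_\ell(Z;2+u)=\sum_{k=0}^{\ell}(2k-1)!!\binom{\ell+k}{2k}u^k\sum_{0\le j\le d/2}(-1)^j\,\frac{d!}{(d-2j)!}\;\beta_j(k)\,S_{d-2j}(Z).$$
   Context: Bessel polynomials: $y_n(x)=\sum_{k=0}^n\frac{(n+k)!}{(n-k)!\,k!\,2^k}x^k$. Let $p,q$ satisfy $p+q=pq=\varpi$, where $\varpi$ is treated as an indeterminate (concretely $p=2/(1-\tau)$, $q=2/(1+\tau)$, $\varpi=4/(1-\tau^2)$). Put $y_\ell(ps)\,y_\ell(qs)=\sum_{n=0}^{2\ell}G_n^{(\ell)}s^n$ (the $G_n^{(\ell)}$ are polynomials in $\varpi$) and $F_\ell(Z)=\sum_{n=0}^{2\ell}\dfrac{G_n^{(\ell)}}{(Z-1)(Z-2)\cdots(Z-n)}$. The numerators $P_\ell$ are defined by $$F_\ell(Z)=\frac{P_\ell(Z;\varpi)}{(Z-2)(Z-4)\cdots(Z-2\ell)};$$ $P_\ell\in\mathbb Z[\varpi][Z]$ is monic of degree $\ell$ in $Z$ (e.g. $P_0=1$, $P_1=Z+\varpi-2$). Write $u=\varpi-2$. Ballot numbers: $\beta_j(k)=\dfrac{k}{2j+k}\dbinom{2j+k}{j}$, with $\beta_0(k)=1$ for all $k\ge0$ (and $\beta_j(0)=0$ for $j\ge1$). Convention $(-1)!!=1$. Midpoint numerators: $S_{2m}(Z)=\prod_{j=1}^m\bigl(Z^2-(4j-2)^2\bigr)$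 and $S_{2m+1}(Z)=Z\prod_{j=1}^m\bigl(Z^2-16j^2\bigr)$ for $m\ge0$. *)

theory Defs
  imports
    "HOL-Computational_Algebra.Polynomial"
    "HOL-Computational_Algebra.Polynomial_Factorial"
begin

definition bessel_poly :: "nat \<Rightarrow> rat poly" where
  "bessel_poly n = (\<Sum>k\<le>n. monom (fact (n + k) / (fact (n - k) * fact k * 2 ^ k)) k)"

text \<open>
  The field \<open>\<rat>(\<tau>)\<close> is \<^typ>\<open>rat poly fract\<close>, with \<open>\<tau>\<close> the polynomial variable.
\<close>

definition const_tau :: "rat \<Rightarrow> rat poly fract" where
  "const_tau c = to_fract [:c:]"

definition tau :: "rat poly fract" where
  "tau = to_fract [:0, 1:]"

definition p_tau :: "rat poly fract" where
  "p_tau = 2 / (1 - tau)"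

definition q_tau :: "rat poly fract" where
  "q_tau = 2 / (1 + tau)"

definition varpi_tau :: "rat poly fract" where
  "varpi_tau = 4 / (1 - tau ^ 2)"

text \<open>The product \<open>y\<^sub>l(p s) y\<^sub>l(q s)\<close>, a polynomial in \<open>s\<close> over \<open>\<rat>(\<tau>)\<close>.\<close>

definition bessel_product :: "nat \<Rightarrow> rat poly fract poly" where
  "bessel_product l =
     pcompose (map_poly const_tau (bessel_poly l)) [:0, p_tau:] *
     pcompose (map_poly const_tau (bessel_poly l)) [:0, q_tau:]"

text \<open>
  The coefficient of \<open>s\<^sup>n\<close> rewritten as a polynomial in the indeterminate \<open>\<varpi>\<close>. It exists and is
  unique, see \<open>G_coeff_ex1\<close> and \<open>poly_G_coeff\<close> below.
\<close>

definition G_coeff :: "nat \<Rightarrow> nat \<Rightarrow> rat poly" where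
  "G_coeff l n = (THE g. poly (map_poly const_tau g) varpi_tau = coeff (bessel_product l) n)"

text \<open>
  From here on, elements of \<open>\<rat>[\<varpi>][Z]\<close> have type \<^typ>\<open>rat poly poly\<close>: the outer variable is \<open>Z\<close>
  and the inner one is \<open>\<varpi>\<close>. Rational functions have type \<^typ>\<open>rat poly poly fract\<close>.
\<close>

definition F_rat :: "nat \<Rightarrow> rat poly poly fract" where
  "F_rat l = (\<Sum>n\<le>2 * l. to_fract [:G_coeff l n:] / to_fract (\<Prod>i=1..n. [:- of_nat i, 1:]))"

text \<open>
  The numerator, obtained by clearing the denominator \<open>(Z - 2)(Z - 4)\<dots>(Z - 2l)\<close>. A priori this is
  only a rational function.
\<close>

definition P_num :: "nat \<Rightarrow> rat poly poly fract" where
  "P_num l = F_rat l * to_fract (\<Prod>i=1..l. [:- of_nat (2 * i), 1:])"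

definition ballot :: "nat \<Rightarrow> nat \<Rightarrow> rat" where
  "ballot j k =
     (if j = 0 then 1 else of_nat k / of_nat (2 * j + k) * of_nat ((2 * j + k) choose j))"

text \<open>The double factorial \<open>(2k - 1)!!\<close>, with value \<open>1\<close> at \<open>k = 0\<close>.\<close>

definition odd_dfact :: "nat \<Rightarrow> rat" where
  "odd_dfact k = (\<Prod>i=1..k. of_nat (2 * i - 1))"

text \<open>
  The midpoint numerators; \<open>monom 1 2 - [:c:]\<close> is \<open>Z\<^sup>2 - c\<close>.
\<close>

definition S_mid :: "nat \<Rightarrow> rat poly poly" where
  "S_mid n =
     (if even n then \<Prod>j=1..n div 2. (monom 1 2 - [:of_nat ((4 * j - 2) ^ 2):])
      else monom 1 1 * (\<Prod>j=1..n div 2. (monom 1 2 - [:of_nat (16 * j ^ 2):])))"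

text \<open>The element \<open>\<varpi> - 2\<close> of \<open>\<rat>[\<varpi>]\<close>.\<close>

definition u_var :: "rat poly" where
  "u_var = [:-2, 1:]"


subsection \<open>Well-definedness of \<^const>\<open>G_coeff\<close>\<close>

lemma const_tau_0 [simp]: "const_tau 0 = 0"
  and const_tau_1 [simp]: "const_tau 1 = 1"
  and const_tau_add: "const_tau (a + b) = const_tau a + const_tau b"
  and const_tau_mult: "const_tau (a * b) = const_tau a * const_tau b"
proof -
  show "const_tau 0 = 0" by (simp add: const_tau_def)
  show "const_tau 1 = 1" by (simp add: const_tau_def flip: one_pCons)
  have "to_fract [:a + b:] = to_fract ([:a:] + [:b:])" by simp
  then show "const_tau (a + b) = const_tau a + const_tau b"
    by (simp only: const_tau_def to_fract_add)
  have "to_fract [:a * b:] = to_fract ([:a:] * [:b:])" by simp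
  then show "const_tau (a * b) = const_tau a * const_tau b"
    by (simp only: const_tau_def to_fract_mult)
qed

lemma const_tau_eq_0_iff [simp]: "const_tau a = 0 \<longleftrightarrow> a = 0"
  by (simp add: const_tau_def)

lemma const_tau_minus_1: "const_tau (- 1) = - 1"
  using const_tau_add [of "- 1" 1] by (simp add: eq_neg_iff_add_eq_0)

lemma map_poly_const_tau_add:
  "map_poly const_tau (f + g) = map_poly const_tau f + map_poly const_tau g"
  by (rule poly_eqI) (simp add: coeff_map_poly const_tau_add)

lemma map_poly_const_tau_smult:
  "map_poly const_tau (smult c f) = smult (const_tau c) (map_poly const_tau f)"
  by (rule poly_eqI) (simp add: coeff_map_poly const_tau_mult)

lemma map_poly_const_tau_mult:
  "map_poly const_tau (f * g) = map_poly const_tau f * map_poly const_tau g"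
proof (induction f)
  case (pCons a f)
  have "map_poly const_tau (pCons 0 (f * g)) = pCons 0 (map_poly const_tau (f * g))"
    by (simp add: map_poly_pCons)
  then show ?case
    using pCons.IH
    by (simp add: map_poly_pCons map_poly_const_tau_add map_poly_const_tau_smult)
qed simp

lemma tau_ne: "1 - tau \<noteq> 0" "1 + tau \<noteq> 0"
proof -
  have "1 - tau = to_fract (1 - [:0, 1:])" "1 + tau = to_fract (1 + [:0, 1:])"
    by (simp_all only: tau_def to_fract_add to_fract_diff to_fract_1)
  moreover have "1 - [:0, 1:] \<noteq> (0 :: rat poly)" "1 + [:0, 1:] \<noteq> (0 :: rat poly)"
    by (simp_all add: one_pCons)
  ultimately show "1 - tau \<noteq> 0" "1 + tau \<noteq> 0"
    by (simp_all only: to_fract_eq_0_iff not_False_eq_True)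
qed

lemma one_minus_tau_sq: "1 - tau ^ 2 = (1 - tau) * (1 + tau)"
  by (simp add: algebra_simps power2_eq_square)

lemma pq_tau: "p_tau + q_tau = varpi_tau" "p_tau * q_tau = varpi_tau"
proof -
  show "p_tau + q_tau = varpi_tau"
    unfolding p_tau_def q_tau_def varpi_tau_def one_minus_tau_sq using tau_ne
    by (simp add: add_frac_eq)
  show "p_tau * q_tau = varpi_tau"
    unfolding p_tau_def q_tau_def varpi_tau_def one_minus_tau_sq by simp
qed

lemma poly_map_poly_const_tau:
  "poly (map_poly const_tau f) (to_fract r) = to_fract (pcompose f r)"
  by (induction f)
     (simp_all add: map_poly_pCons pcompose_pCons const_tau_def)

lemma varpi_tau_transcendental:
  assumes "poly (map_poly const_tau g) varpi_tau = 0"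
  shows "g = 0"
proof -
  define r :: "rat poly" where "r = [:1/4, 0, -1/4:]"
  have r4: "to_fract r * 4 = 1 - tau ^ 2"
  proof -
    have "r * [:4:] = 1 - [:0, 1:] ^ 2"
      by (simp add: r_def one_pCons power2_eq_square)
    moreover have "to_fract [:4 :: rat:] = 4"
    proof -
      have "[:4 :: rat:] = 1 + 1 + 1 + 1"
        by (simp add: one_pCons)
      then have "to_fract [:4 :: rat:] = 1 + 1 + 1 + 1"
        by (simp only: to_fract_add to_fract_1)
      then show ?thesis by simp
    qed
    ultimately show ?thesis
      by (metis tau_def to_fract_mult to_fract_diff to_fract_1 power2_eq_square)
  qed
  have ne: "1 - tau ^ 2 \<noteq> 0"
    using tau_ne by (simp add: one_minus_tau_sq)
  then have four: "(4 :: rat poly fract) \<noteq> 0"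
    using r4 by auto
  have inv: "inverse varpi_tau = to_fract r"
    using r4 ne four by (simp add: varpi_tau_def field_simps)
  have v: "varpi_tau \<noteq> 0"
    using ne four by (simp add: varpi_tau_def)
  have "reflect_poly (map_poly const_tau g) = map_poly const_tau (reflect_poly g)"
    by (rule poly_eqI) (simp add: coeff_reflect_poly coeff_map_poly degree_map_poly)
  moreover have "poly (reflect_poly (map_poly const_tau g)) (inverse varpi_tau) = 0"
    using assms v by (simp add: poly_reflect_poly_nz)
  ultimately have "pcompose (reflect_poly g) r = 0"
    by (simp add: inv poly_map_poly_const_tau)
  then have "reflect_poly g = 0"
    by (rule pcompose_eq_0) (simp add: r_def)
  then show ?thesis by simp
qed

lemma G_coeff_ex1:
  "\<exists>!g. poly (map_poly const_tau g) varpi_tau = coeff (bessel_product l) n"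
proof -
  define R where "R = range (\<lambda>g. poly (map_poly const_tau g) varpi_tau)"
  have R_add: "x + y \<in> R" if "x \<in> R" "y \<in> R" for x y
    using that unfolding R_def by (auto simp flip: poly_add map_poly_const_tau_add)
  have R_mult: "x * y \<in> R" if "x \<in> R" "y \<in> R" for x y
    using that unfolding R_def by (auto simp flip: poly_mult map_poly_const_tau_mult)
  have R_const: "const_tau c \<in> R" for c
    unfolding R_def by (rule image_eqI [where x = "[:c:]"]) (simp_all add: map_poly_pCons)
  have R_varpi: "varpi_tau \<in> R"
    unfolding R_def by (rule image_eqI [where x = "[:0, 1:]"]) (simp_all add: map_poly_pCons)
  have R_0: "0 \<in> R" and R_1: "1 \<in> R" and R_m1: "- 1 \<in> R"
    using R_const [of 0] R_const [of 1] R_const [of "- 1"]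
    by (simp_all add: const_tau_minus_1)
  have R_pow: "varpi_tau ^ k \<in> R" for k
    by (induction k) (auto intro: R_1 R_mult R_varpi)
  have R_sum: "(\<Sum>i\<in>A. h i) \<in> R" if "\<And>i. h i \<in> R" for A :: "nat set" and h
    by (induction A rule: infinite_finite_induct) (auto intro: R_0 R_add that)
  have R_powsum: "p_tau ^ k + q_tau ^ k \<in> R" for k
  proof (induction k rule: less_induct)
    case (less k)
    consider "k = 0" | "k = 1" | m where "k = Suc (Suc m)"
      by (metis One_nat_def not0_implies_Suc)
    then show ?case
    proof cases
      case 3
      have "p_tau ^ k + q_tau ^ k =
          (p_tau + q_tau) * (p_tau ^ Suc m + q_tau ^ Suc m)
            + (- 1) * ((p_tau * q_tau) * (p_tau ^ m + q_tau ^ m))"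
        by (simp add: 3 algebra_simps)
      also have "\<dots> \<in> R"
        unfolding pq_tau
        by (rule R_add [OF R_mult [OF R_varpi less.IH]
              R_mult [OF R_m1 R_mult [OF R_varpi less.IH]]]) (simp_all add: 3)
      finally show ?thesis .
    qed (use R_add [OF R_1 R_1] R_varpi pq_tau in simp_all)
  qed
  have R_sym': "p_tau ^ a * q_tau ^ b + p_tau ^ b * q_tau ^ a \<in> R" if "a \<le> b" for a b
  proof -
    obtain k where "b = a + k"
      using le_Suc_ex [OF \<open>a \<le> b\<close>] by blast
    then have "p_tau ^ a * q_tau ^ b + p_tau ^ b * q_tau ^ a =
        (p_tau * q_tau) ^ a * (p_tau ^ k + q_tau ^ k)"
      by (simp add: power_add power_mult_distrib algebra_simps)
    then show ?thesis
      using R_mult R_pow R_powsum by (simp add: pq_tau)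
  qed
  have R_sym: "p_tau ^ a * q_tau ^ b + p_tau ^ b * q_tau ^ a \<in> R" for a b
    using R_sym' [of a b] R_sym' [of b a] by (cases "a \<le> b") (simp_all add: add.commute)
  define c where "c i = const_tau (coeff (bessel_poly l) i)" for i
  define t where "t i = c i * c (n - i) * (p_tau ^ i * q_tau ^ (n - i))" for i
  have coeff_scale: "coeff (pcompose f [:0, x:]) i = x ^ i * coeff f i"
    for f :: "rat poly fract poly" and x i
    by (simp add: coeff_pcompose_linear)
  have "coeff (bessel_product l) n = (\<Sum>i\<le>n. t i)"
    by (simp add: bessel_product_def coeff_mult coeff_scale coeff_map_poly t_def c_def mult_ac)
  moreover have "(\<Sum>i\<le>n. t i) = (\<Sum>i\<le>n. t (n - i))"
    by (rule sum.reindex_bij_witness [where i = "\<lambda>i. n - i" and j = "\<lambda>i. n - i"]) auto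
  ultimately have "coeff (bessel_product l) n + coeff (bessel_product l) n =
      (\<Sum>i\<le>n. t i + t (n - i))"
    by (simp add: sum.distrib)
  also have "\<dots> = (\<Sum>i\<le>n. c i * c (n - i) *
      (p_tau ^ i * q_tau ^ (n - i) + p_tau ^ (n - i) * q_tau ^ i))"
    by (rule sum.cong) (auto simp: t_def algebra_simps)
  also have "\<dots> \<in> R"
    by (intro R_sum R_mult R_sym) (simp_all add: c_def R_const)
  finally have "const_tau (1/2) * (coeff (bessel_product l) n + coeff (bessel_product l) n) \<in> R"
    by (intro R_mult R_const)
  also have "const_tau (1/2) * (x + x) = x" for x
  proof -
    have "const_tau (1/2) * (x + x) = (const_tau (1/2) + const_tau (1/2)) * x"
      by (simp only: distrib_left distrib_right)
    also have "const_tau (1/2) + const_tau (1/2) = 1"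
      by (simp flip: const_tau_add)
    finally show ?thesis by simp
  qed
  finally obtain g where g:
    "poly (map_poly const_tau g) varpi_tau = coeff (bessel_product l) n"
    unfolding R_def by auto
  show ?thesis
  proof (rule ex1I [of _ g])
    fix h
    assume h: "poly (map_poly const_tau h) varpi_tau = coeff (bessel_product l) n"
    have "map_poly const_tau (h + smult (- 1) g) =
        map_poly const_tau h + smult (const_tau (- 1)) (map_poly const_tau g)"
      by (simp only: map_poly_const_tau_add map_poly_const_tau_smult)
    then have "h + smult (- 1) g = 0"
      using g h by (intro varpi_tau_transcendental) (simp add: const_tau_minus_1)
    then show "h = g" by simp
  qed (fact g)
qed

lemma poly_G_coeff: "poly (map_poly const_tau (G_coeff l n)) varpi_tau = coeff (bessel_product l) n"
  unfolding G_coeff_def by (rule theI' [OF G_coeff_ex1])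

end

theory Submission
  imports Defs
begin

text \<open>
  The two sides meet in the Newton-type expansion
  \[ P_l = \sum_{i \le l} b_{l,i}\, \varpi^i \prod_{j=i+1}^{l} (Z - 2j), \qquad
     b_{l,i} = \frac{(l+i)!}{(l-i)!\,i!\,2^i}, \]
  where the \<open>b\<^sub>l\<^sub>,\<^sub>i\<close> are the coefficients of the Bessel polynomial \<open>y\<^sub>l\<close>.

  To reach it from the definition, one needs the coefficients of \<open>y\<^sub>l(ps) y\<^sub>l(qs)\<close> in terms of
  \<open>p + q\<close> and \<open>pq\<close>. Up to a factor depending only on \<open>k\<close>, the number \<open>b\<^sub>l\<^sub>,\<^sub>k\<close> is the product of
  the differences \<open>l(l+1) - i(i+1)\<close> over \<open>i < k\<close>. Multiplying two such Newton basis polynomials and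
  expanding the product in the Newton basis again (\<open>bessel_newton_mult\<close>) gives
  \[ y_l(x)\, y_l(y) = \sum_i b_{l,i}\, (x+y)^i\, y_i\Bigl(\frac{xy}{x+y}\Bigr) \]
  in the coefficientwise form \<open>bessel_product_coeff\<close>. With \<open>p + q = pq = \<varpi>\<close> the right-hand side at
  \<open>x = ps\<close>, \<open>y = qs\<close> is \<open>\<Sum>\<^sub>i b\<^sub>l\<^sub>,\<^sub>i \<varpi>\<^sup>i s\<^sup>i y\<^sub>i(s)\<close>. Replacing \<open>s\<^sup>n\<close> by
  \<open>1/((Z-1)\<dots>(Z-n))\<close> sends \<open>s\<^sup>i y\<^sub>i(s)\<close> to \<open>1/((Z-2)(Z-4)\<dots>(Z-2i))\<close>
  (\<open>sum_bessel_coeff_factorial_series\<close>), and the expansion of \<open>P\<^sub>l\<close> follows (\<open>P_num_eq\<close>).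

  Substituting \<open>\<varpi> = 2 + u\<close> and collecting powers of \<open>u\<close> leaves, next to the factor
  \<open>b\<^sub>l\<^sub>,\<^sub>k u\<^sup>k\<close> with \<open>b\<^sub>l\<^sub>,\<^sub>k = (2k-1)!! binom(l+k, 2k)\<close>, the polynomial \<open>mid_sum (l - k) k\<close> in \<open>Z\<close>.
  The claim is therefore that this polynomial is the alternating ballot sum of midpoint numerators.
  As functions of \<open>d\<close> and \<open>k\<close>, both satisfy
  \[ Q_{d,k+1} = Q_{d,k} - d(d-1)\, Q_{d-2,k+2} \]
  (\<open>mid_sum_rec\<close>, \<open>ballot_sum_rec\<close>). This recurrence lowers \<open>d\<close> or \<open>k\<close>, so the sequences agree as soon
  as they agree at \<open>k = 0\<close>, where both are \<open>S\<^sub>d(Z)\<close> (\<open>mid_sum_0_eq_S_mid\<close>).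

  The recurrence is the functional equation of the Catalan series in disguise: with \<open>C\<close> the power
  series determined by \<open>C = 1 - x\<^sup>2 C\<^sup>2\<close>, the exponential generating function of \<open>Q\<^sub>d\<^sub>,\<^sub>k\<close> in \<open>d\<close> is
  \<open>C\<^sup>k\<close> times that of \<open>S\<^sub>d\<close>, and \<open>C\<^bsup>k+1\<^esup> = C\<^sup>k - x\<^sup>2 C\<^bsup>k+2\<^esup>\<close>.
\<close>

section \<open>Coefficients of Bessel polynomials\<close>

text \<open>
  The coefficients are natural numbers. Keeping them in \<^typ>\<open>nat\<close> lets the same coefficient be read in
  each of the rings used below, and the binomial factor makes them vanish above the degree.
\<close>
definition bessel_coeff :: "nat \<Rightarrow> nat \<Rightarrow> nat" where
  "bessel_coeff n k = ((n + k) choose (2 * k)) * (\<Prod>i=1..k. 2 * i - 1)"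

lemma bessel_coeff_0_right [simp]: "bessel_coeff n 0 = 1"
  by (simp add: bessel_coeff_def)

lemma bessel_coeff_eq_0 [simp]: "n < k \<Longrightarrow> bessel_coeff n k = 0"
  by (simp add: bessel_coeff_def)

lemma odd_prod_fact: "(\<Prod>i=1..k. 2 * i - 1) * (fact k * 2 ^ k) = (fact (2 * k) :: nat)"
proof (induction k)
  case (Suc k)
  have "(\<Prod>i=1..Suc k. 2 * i - 1) * (fact (Suc k) * 2 ^ Suc k) =
      ((\<Prod>i=1..k. 2 * i - 1) * (fact k * 2 ^ k)) * ((2 * k + 1) * (2 * k + 2))"
    by (simp add: algebra_simps)
  also have "\<dots> = fact (2 * Suc k)"
    unfolding Suc.IH by (simp add: algebra_simps)
  finally show ?case .
qed simp

lemma bessel_coeff_fact: "bessel_coeff (k + r) k * (fact r * fact k * 2 ^ k) = fact (2 * k + r)"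
proof -
  have "((2 * k + r) choose (2 * k)) * (fact (2 * k) * fact r) = (fact (2 * k + r) :: nat)"
    using binomial_fact_lemma [of "2 * k" "2 * k + r"] by (simp add: mult_ac)
  moreover have "k + r + k = 2 * k + r"
    by simp
  ultimately show ?thesis
    unfolding bessel_coeff_def odd_prod_fact [symmetric] by (simp only: mult_ac)
qed

lemma of_nat_bessel_coeff:
  "of_nat (bessel_coeff (k + r) k) =
     (fact (2 * k + r) / (fact r * fact k * 2 ^ k) :: 'a :: field_char_0)"
proof -
  have "of_nat (bessel_coeff (k + r) k * (fact r * fact k * 2 ^ k)) = (fact (2 * k + r) :: 'a)"
    unfolding bessel_coeff_fact by simp
  then show ?thesis
    by (simp add: field_simps)
qed

lemma coeff_bessel_poly: "coeff (bessel_poly n) k = of_nat (bessel_coeff n k)"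
proof (cases "k \<le> n")
  case True
  then obtain r where n: "n = k + r"
    using le_Suc_ex by blast
  show ?thesis
    using of_nat_bessel_coeff [of k r, where 'a = rat] True
    by (simp add: bessel_poly_def coeff_sum n mult_2 add_ac)
qed (simp add: bessel_poly_def coeff_sum)

text \<open>
  This contiguity relation between \<open>y\<^bsub>n+1\<^esub>\<close> and \<open>y\<^sub>n\<close> is exactly what removes one factor
  \<open>Z - 2(n+1)\<close> from the inverse factorial series of \<open>sum_bessel_coeff_factorial_series\<close>.
\<close>
lemma bessel_coeff_Suc_Suc:
  assumes "k \<le> n"
  shows "bessel_coeff (Suc n) (Suc k) =
    (Suc n - k) * bessel_coeff (Suc n) k + bessel_coeff n (Suc k)"
proof -
  obtain r where n: "n = k + r"
    using assms le_Suc_ex by blast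
  show ?thesis
  proof (cases r)
    case 0
    have "of_nat (bessel_coeff (Suc n) (Suc k)) = (of_nat (bessel_coeff (Suc n) k) :: rat)"
    proof -
      have 1: "of_nat (bessel_coeff (Suc n) (Suc k)) =
          (fact (2 * k + 2) / (fact (k + 1) * 2 ^ (k + 1)) :: rat)"
        using of_nat_bessel_coeff [of "Suc k" 0, where 'a = rat] by (simp add: n 0)
      have 2: "of_nat (bessel_coeff (Suc n) k) = (fact (2 * k + 1) / (fact k * 2 ^ k) :: rat)"
        using of_nat_bessel_coeff [of k 1, where 'a = rat] by (simp add: n 0)
      have 3: "fact (2 * k + 2) = (of_nat (2 * k + 2) * fact (2 * k + 1) :: rat)"
        "fact (k + 1) = (of_nat (k + 1) * fact k :: rat)"
        by (simp_all add: numeral_eq_Suc del: of_nat_Suc)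
      show ?thesis
        unfolding 1 2 3 by (simp add: divide_simps)
    qed
    then show ?thesis
      by (simp add: n 0)
  next
    case (Suc s)
    have "of_nat (bessel_coeff (Suc n) (Suc k)) =
      (of_nat (Suc n - k) * of_nat (bessel_coeff (Suc n) k) + of_nat (bessel_coeff n (Suc k)) :: rat)"
    proof -
      have 1: "of_nat (bessel_coeff (Suc n) (Suc k)) =
          (fact (2 * k + s + 3) / (fact (s + 1) * fact (k + 1) * 2 ^ (k + 1)) :: rat)"
      proof -
        have "Suc n = Suc k + Suc s" "2 * k + s + 3 = 2 * Suc k + Suc s" "s + 1 = Suc s" "k + 1 = Suc k"
          by (simp_all add: n Suc)
        then show ?thesis
          by (simp only: of_nat_bessel_coeff)
      qed
      have 2: "of_nat (bessel_coeff (Suc n) k) =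
          (fact (2 * k + s + 2) / (fact (s + 2) * fact k * 2 ^ k) :: rat)"
      proof -
        have "Suc n = k + (s + 2)" "2 * k + s + 2 = 2 * k + (s + 2)"
          by (simp_all add: n Suc)
        then show ?thesis
          by (simp only: of_nat_bessel_coeff)
      qed
      have 3: "of_nat (bessel_coeff n (Suc k)) =
          (fact (2 * k + s + 2) / (fact s * fact (k + 1) * 2 ^ (k + 1)) :: rat)"
      proof -
        have "n = Suc k + s" "2 * k + s + 2 = 2 * Suc k + s" "k + 1 = Suc k"
          by (simp_all add: n Suc)
        then show ?thesis
          by (simp only: of_nat_bessel_coeff)
      qed
      have 4: "fact (2 * k + s + 3) = (of_nat (2 * k + s + 3) * fact (2 * k + s + 2) :: rat)"
        "fact (s + 1) = (of_nat (s + 1) * fact s :: rat)"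
        "fact (s + 2) = (of_nat (s + 2) * (of_nat (s + 1) * fact s) :: rat)"
        "fact (k + 1) = (of_nat (k + 1) * fact k :: rat)"
        by (simp_all add: numeral_eq_Suc del: of_nat_Suc)
      show ?thesis
        unfolding 1 2 3 4 by (simp add: n Suc divide_simps) (simp add: algebra_simps)
    qed
    then show ?thesis
      by (simp flip: of_nat_mult of_nat_add del: of_nat_Suc)
  qed
qed

section \<open>The product of two Bessel polynomials\<close>

text \<open>
  At \<open>x = l(l+1)\<close> each factor is \<open>l(l+1) - i(i+1) = (l-i)(l+i+1)\<close>, so the product telescopes to
  \<open>(l+n)!/(l-n)!\<close>: up to constant factors, the coefficients of \<open>y\<^sub>l\<close>, as functions of \<open>l(l+1)\<close>,
  form a Newton basis with nodes \<open>i(i+1)\<close>.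
\<close>
definition bessel_newton :: "nat \<Rightarrow> 'a :: comm_ring_1 \<Rightarrow> 'a" where
  "bessel_newton n x = (\<Prod>i<n. x - of_nat (i * Suc i))"

lemma bessel_newton_0 [simp]: "bessel_newton 0 x = 1"
  and bessel_newton_Suc: "bessel_newton (Suc n) x = bessel_newton n x * (x - of_nat (n * Suc n))"
  by (simp_all add: bessel_newton_def)

text \<open>
  The linearization coefficients
  \[ \frac{(a+c)!\,a!\,c!}{(a+c-m)!\,m!\,(a-m)!\,(c-m)!}, \]
  written with binomials so that they vanish outside \<open>m \<le> min a c\<close>.
\<close>
definition newton_lin :: "nat \<Rightarrow> nat \<Rightarrow> nat \<Rightarrow> nat" where
  "newton_lin a c m = ((a + c) choose m) * (a choose m) * (c choose m) * (fact m)\<^sup>2"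

lemma newton_lin_0 [simp]: "newton_lin a c 0 = 1"
  by (simp add: newton_lin_def)

lemma Suc_times_choose_Suc: "Suc m * (n choose Suc m) = (n - m) * (n choose m)"
  by (simp only: binomial_absorption binomial_absorb_comp)

text \<open>
  Each of the three binomials at \<open>m + 1\<close> is a multiple of its value at \<open>m\<close> after multiplication by
  \<open>m + 1\<close>. For \<open>j = a+c-m\<close> one has \<open>j(j+1) - c(c+1) = (a-m)(a+2c-m+1)\<close>, so after
  dividing out \<open>(a-m) newton_lin a c m\<close> the claim becomes
  \<open>(a+c+1)(c+1) = (a+c-m)(c-m) + (m+1)(a+2c-m+1)\<close>.
\<close>
lemma newton_lin_Suc:
  assumes "m \<le> c"
  shows "int (newton_lin a (Suc c) (Suc m)) =
    int (newton_lin a c (Suc m)) +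
    int (newton_lin a c m) * (int ((a + c - m) * Suc (a + c - m)) - int (c * Suc c))"
proof (cases "m \<le> a")
  case True
  obtain r s where a: "a = m + r" and c: "c = m + s"
    using True assms le_Suc_ex by metis
  define h where "h = int (newton_lin a c m)"
  have "Suc m * newton_lin a c (Suc m) =
      (Suc m * ((a + c) choose Suc m)) * (Suc m * (a choose Suc m)) * (Suc m * (c choose Suc m)) * (fact m)\<^sup>2"
    by (simp only: newton_lin_def fact_Suc power2_eq_square of_nat_id mult_ac)
  also have "\<dots> = (m + r + s) * r * s * newton_lin a c m"
    unfolding Suc_times_choose_Suc by (simp add: newton_lin_def a c)
  finally have 1: "int (Suc m) * int (newton_lin a c (Suc m)) = (int m + r + s) * r * s * h"
    unfolding h_def of_nat_mult [symmetric] by simp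
  have "Suc m * newton_lin a (Suc c) (Suc m) =
      (Suc m * (Suc (a + c) choose Suc m)) * (Suc m * (a choose Suc m)) * (Suc m * (Suc c choose Suc m)) * (fact m)\<^sup>2"
    by (simp only: newton_lin_def fact_Suc power2_eq_square of_nat_id add_Suc_right mult_ac)
  also have "\<dots> = Suc (a + c) * r * Suc c * newton_lin a c m"
    unfolding Suc_times_binomial Suc_times_choose_Suc [of m a] by (simp add: newton_lin_def a algebra_simps)
  finally have 2: "int (Suc m) * int (newton_lin a (Suc c) (Suc m)) = int (Suc (a + c)) * r * int (Suc c) * h"
    unfolding h_def of_nat_mult [symmetric] by simp
  have "int (Suc m) * int (newton_lin a (Suc c) (Suc m)) = int (Suc m) * (int (newton_lin a c (Suc m)) +
    h * (int ((a + c - m) * Suc (a + c - m)) - int (c * Suc c)))"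
    unfolding distrib_left 1 2 by (simp add: a c algebra_simps)
  then show ?thesis
    unfolding mult_cancel_left h_def by simp
qed (simp add: newton_lin_def binomial_eq_0)

text \<open>
  Induction on \<open>c\<close>: the new factor \<open>x - c(c+1)\<close> differs from the factor \<open>x - j(j+1)\<close> that extends the
  \<open>j\<close>-th basis element by a constant, so it acts on the basis by a two-term rule.
\<close>
lemma bessel_newton_mult:
  "bessel_newton a x * bessel_newton c x =
     (\<Sum>m\<le>c. of_nat (newton_lin a c m) * bessel_newton (a + c - m) x)"
proof (induction c)
  case (Suc c)
  let ?N = "\<lambda>n. bessel_newton n x" and ?h = "\<lambda>c m. of_nat (newton_lin a c m) :: 'a"
  let ?e = "\<lambda>m. int ((a + c - m) * Suc (a + c - m)) - int (c * Suc c)"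
  have step: "?N (a + c - m) * (x - of_nat (c * Suc c)) = ?N (a + Suc c - m) + of_int (?e m) * ?N (a + c - m)"
    if "m \<le> c" for m
  proof -
    have "a + Suc c - m = Suc (a + c - m)"
      using that by simp
    then show ?thesis
      by (simp add: bessel_newton_Suc algebra_simps)
  qed
  have "?N a * ?N (Suc c) = (\<Sum>m\<le>c. ?h c m * ?N (a + c - m)) * (x - of_nat (c * Suc c))"
    unfolding Suc.IH [symmetric] by (simp add: bessel_newton_Suc mult_ac)
  also have "\<dots> = (\<Sum>m\<le>c. ?h c m * ?N (a + Suc c - m)) + (\<Sum>m\<le>c. ?h c m * of_int (?e m) * ?N (a + c - m))"
    unfolding sum_distrib_right sum.distrib [symmetric]
    by (rule sum.cong [OF refl]) (simp only: mult.assoc step atMost_iff distrib_left)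
  \<comment> \<open>The coefficient at \<open>m = c + 1\<close> is zero; adding it aligns the two sums after an index shift.\<close>
  also have "(\<Sum>m\<le>c. ?h c m * ?N (a + Suc c - m)) = (\<Sum>m\<le>Suc c. ?h c m * ?N (a + Suc c - m))"
    by (simp add: newton_lin_def binomial_eq_0)
  also have "\<dots> = ?N (a + Suc c) + (\<Sum>m\<le>c. ?h c (Suc m) * ?N (a + c - m))"
    unfolding sum.atMost_Suc_shift by simp
  also have "\<dots> + (\<Sum>m\<le>c. ?h c m * of_int (?e m) * ?N (a + c - m)) =
      ?N (a + Suc c) + (\<Sum>m\<le>c. (?h c (Suc m) + ?h c m * of_int (?e m)) * ?N (a + c - m))"
    by (simp only: add.assoc sum.distrib [symmetric] distrib_right)
  also have "\<dots> = ?N (a + Suc c) + (\<Sum>m\<le>c. ?h (Suc c) (Suc m) * ?N (a + c - m))"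
  proof -
    have "?h c (Suc m) + ?h c m * of_int (?e m) = ?h (Suc c) (Suc m)" if "m \<le> c" for m
      using arg_cong [OF newton_lin_Suc [OF that, of a], of "of_int :: int \<Rightarrow> 'a"]
      by (simp only: of_int_add of_int_mult of_int_of_nat_eq)
    then show ?thesis
      by simp
  qed
  also have "\<dots> = (\<Sum>m\<le>Suc c. ?h (Suc c) m * ?N (a + Suc c - m))"
    unfolding sum.atMost_Suc_shift by simp
  finally show ?case .
qed simp

lemma of_nat_bessel_coeff_newton:
  "of_nat (bessel_coeff n k) =
     (bessel_newton k (of_nat (n * Suc n)) / (fact k * 2 ^ k) :: 'a :: field_char_0)"
proof (cases "k \<le> n")
  case True
  then obtain r where n: "n = k + r"
    using le_Suc_ex by blast
  have "bessel_newton k (of_nat ((k + r) * Suc (k + r))) * fact r = (fact (2 * k + r) :: 'a)"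
  proof (induction k arbitrary: r)
    case (Suc k)
    have "bessel_newton (Suc k) (of_nat ((Suc k + r) * Suc (Suc k + r))) * fact r =
        bessel_newton k (of_nat ((k + Suc r) * Suc (k + Suc r))) * fact (Suc r) * (of_nat (2 * k + r + 2) :: 'a)"
      by (simp add: bessel_newton_Suc algebra_simps)
    also have "\<dots> = fact (2 * Suc k + r)"
      unfolding Suc.IH by (simp add: algebra_simps)
    finally show ?case .
  qed simp
  then show ?thesis
    unfolding n of_nat_bessel_coeff by (simp add: field_simps)
next
  case False
  then have "bessel_newton k (of_nat (n * Suc n)) = (0 :: 'a)"
    by (auto simp: bessel_newton_def intro!: prod_zero)
  then show ?thesis
    using False by simp
qed

text \<open>
  The linearization evaluated at \<open>x = n(n+1)\<close>. The linearization coefficient, divided by the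
  normalizations \<open>a! 2\<^sup>a\<close> and \<open>c! 2\<^sup>c\<close>, splits into a Bessel coefficient of degree \<open>a + c - m\<close> and the
  binomial that the expansion of \<open>(x + y)\<^bsup>a+c-2m\<^esup>\<close> produces.
\<close>
lemma bessel_coeff_mult:
  "bessel_coeff n a * bessel_coeff n c =
     (\<Sum>m\<le>min a c. bessel_coeff n (a + c - m) * bessel_coeff (a + c - m) m *
        ((a + c - 2 * m) choose (a - m)))"
proof -
  define x :: rat where "x = of_nat (n * Suc n)"
  have "of_nat (bessel_coeff n a * bessel_coeff n c) =
      (bessel_newton a x * bessel_newton c x) / (fact a * fact c * 2 ^ (a + c))"
    by (simp add: of_nat_bessel_coeff_newton x_def power_add)
  also have "\<dots> = (\<Sum>m\<le>c. of_nat (newton_lin a c m) * bessel_newton (a + c - m) x /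
      (fact a * fact c * 2 ^ (a + c)))"
    by (simp add: bessel_newton_mult sum_divide_distrib)
  also have "\<dots> = (\<Sum>m\<le>min a c. of_nat (newton_lin a c m) * bessel_newton (a + c - m) x /
      (fact a * fact c * 2 ^ (a + c)))"
    by (rule sum.mono_neutral_right) (auto simp: newton_lin_def)
  also have "\<dots> = (\<Sum>m\<le>min a c. of_nat (bessel_coeff n (a + c - m) * bessel_coeff (a + c - m) m *
        ((a + c - 2 * m) choose (a - m))))"
  proof (rule sum.cong [OF refl])
    fix m assume "m \<in> {..min a c}"
    then obtain r s where a: "a = m + r" and c: "c = m + s"
      using le_Suc_ex by (metis atMost_iff min.bounded_iff)
    have 1: "bessel_newton (a + c - m) x = of_nat (bessel_coeff n (a + c - m)) * (fact (a + c - m) * 2 ^ (a + c - m))"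
      by (simp add: of_nat_bessel_coeff_newton x_def)
    have 2: "of_nat (bessel_coeff (a + c - m) m) =
        (fact (a + c) / (fact (r + s) * fact m * 2 ^ m) :: rat)"
    proof -
      have "a + c - m = m + (r + s)" "a + c = 2 * m + (r + s)"
        by (simp_all add: a c)
      then show ?thesis
        by (simp only: of_nat_bessel_coeff)
    qed
    have 3: "of_nat (newton_lin a c m) = (fact (a + c) / (fact m * fact (a + c - m)) *
        (fact a / (fact m * fact r)) * (fact c / (fact m * fact s)) * (fact m)\<^sup>2 :: rat)"
      by (simp add: newton_lin_def binomial_fact a c)
    have 4: "of_nat ((a + c - 2 * m) choose (a - m)) = (fact (r + s) / (fact r * fact s) :: rat)"
      by (simp add: binomial_fact a c)
    have 5: "(2 :: rat) ^ (a + c) = 2 ^ (a + c - m) * 2 ^ m"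
      unfolding power_add [symmetric] by (simp add: a c)
    show "of_nat (newton_lin a c m) * bessel_newton (a + c - m) x /
      (fact a * fact c * 2 ^ (a + c)) = of_nat (bessel_coeff n (a + c - m) * bessel_coeff (a + c - m) m *
        ((a + c - 2 * m) choose (a - m)))"
      unfolding of_nat_mult 1 2 3 4 5 by (simp add: field_simps power2_eq_square)
  qed
  finally show ?thesis
    unfolding of_nat_sum [symmetric] of_nat_eq_iff .
qed

text \<open>
  The part of degree \<open>n\<close> of \<open>y\<^sub>l(x) y\<^sub>l(y) = \<Sum>\<^sub>i b\<^sub>l\<^sub>,\<^sub>i (x+y)\<^sup>i y\<^sub>i(xy/(x+y))\<close>. Since it is a polynomial
  identity, no division by \<open>x + y\<close> occurs.
\<close>
lemma bessel_product_coeff: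
  fixes x y :: "'a :: comm_ring_1"
  shows "(\<Sum>a\<le>n. of_nat (bessel_coeff l a * bessel_coeff l (n - a)) * x ^ a * y ^ (n - a)) =
    (\<Sum>m\<le>n div 2. of_nat (bessel_coeff l (n - m) * bessel_coeff (n - m) m) *
       (x * y) ^ m * (x + y) ^ (n - 2 * m))"
proof -
  let ?b = "\<lambda>m. of_nat (bessel_coeff l (n - m) * bessel_coeff (n - m) m) :: 'a"
  have "(\<Sum>a\<le>n. of_nat (bessel_coeff l a * bessel_coeff l (n - a)) * x ^ a * y ^ (n - a)) =
      (\<Sum>a\<le>n. \<Sum>m\<le>min a (n - a). ?b m * of_nat ((n - 2 * m) choose (a - m)) * x ^ a * y ^ (n - a))"
    by (rule sum.cong [OF refl], subst bessel_coeff_mult) (simp add: sum_distrib_right)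
  also have "\<dots> = (\<Sum>m\<le>n div 2. \<Sum>r\<le>n - 2 * m.
      ?b m * of_nat ((n - 2 * m) choose r) * x ^ (m + r) * y ^ (n - (m + r)))"
    unfolding sum.Sigma [OF finite_atMost ballI [OF finite_atMost]]
    by (rule sum.reindex_bij_witness [where j = "\<lambda>(a, m). (m, a - m)" and i = "\<lambda>(m, r). (m + r, m)"]) auto
  also have "\<dots> = (\<Sum>m\<le>n div 2. ?b m * (x * y) ^ m * (x + y) ^ (n - 2 * m))"
  proof (rule sum.cong [OF refl])
    fix m assume m: "m \<in> {..n div 2}"
    have "?b m * of_nat ((n - 2 * m) choose r) * x ^ (m + r) * y ^ (n - (m + r)) =
        ?b m * (x * y) ^ m * (of_nat ((n - 2 * m) choose r) * x ^ r * y ^ (n - 2 * m - r))"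
      if "r \<le> n - 2 * m" for r
    proof -
      have "n - (m + r) = m + (n - 2 * m - r)"
        using that m by auto
      then show ?thesis
        by (simp only: power_add power_mult_distrib mult_ac)
    qed
    then show "(\<Sum>r\<le>n - 2 * m. ?b m * of_nat ((n - 2 * m) choose r) * x ^ (m + r) * y ^ (n - (m + r))) =
        ?b m * (x * y) ^ m * (x + y) ^ (n - 2 * m)"
      by (simp add: binomial_ring sum_distrib_left)
  qed
  finally show ?thesis .
qed

section \<open>Expansion of the numerators in powers of the indeterminate\<close>

text \<open>
  With \<open>p + q = pq = \<varpi>\<close>, the factor \<open>(pq)\<^sup>m (p+q)\<^bsup>n-2m\<^esup>\<close> collapses to \<open>\<varpi>\<^bsup>n-m\<^esup>\<close>.
\<close>
lemma G_coeff_eq: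
  "G_coeff l n = (\<Sum>m\<le>n div 2. monom (of_nat (bessel_coeff l (n - m) * bessel_coeff (n - m) m)) (n - m))"
    (is "_ = ?g")
proof -
  have const: "const_tau (of_nat k) = of_nat k" for k
    by (induction k) (simp_all add: const_tau_add)
  have scale: "coeff (pcompose (map_poly const_tau (bessel_poly l)) [:0, x:]) a =
      of_nat (bessel_coeff l a) * x ^ a" for x a
    by (simp add: coeff_pcompose_linear coeff_map_poly coeff_bessel_poly const mult.commute)
  have ev: "poly (map_poly const_tau (\<Sum>m\<in>A. monom (of_nat (f m)) (e m))) x =
      (\<Sum>m\<in>A. of_nat (f m) * x ^ e m)" if "finite A" for A :: "nat set" and f e x
    using that
    by (induction A rule: finite_induct)
       (simp_all add: map_poly_const_tau_add map_poly_monom poly_monom const del: of_nat_mult)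
  have "coeff (bessel_product l) n =
      (\<Sum>a\<le>n. of_nat (bessel_coeff l a * bessel_coeff l (n - a)) * p_tau ^ a * q_tau ^ (n - a))"
    unfolding bessel_product_def coeff_mult scale by (simp add: mult_ac)
  also have "\<dots> = (\<Sum>m\<le>n div 2. of_nat (bessel_coeff l (n - m) * bessel_coeff (n - m) m) * varpi_tau ^ (n - m))"
    unfolding bessel_product_coeff pq_tau
  proof (rule sum.cong [OF refl])
    fix m assume "m \<in> {..n div 2}"
    then have "n - m = m + (n - 2 * m)"
      by auto
    then have "varpi_tau ^ (n - m) = varpi_tau ^ m * varpi_tau ^ (n - 2 * m)"
      by (simp only: power_add)
    then show "of_nat (bessel_coeff l (n - m) * bessel_coeff (n - m) m) * varpi_tau ^ m * varpi_tau ^ (n - 2 * m) =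
        of_nat (bessel_coeff l (n - m) * bessel_coeff (n - m) m) * varpi_tau ^ (n - m)"
      by (simp only: mult.assoc)
  qed
  also have "\<dots> = poly (map_poly const_tau ?g) varpi_tau"
    by (simp add: ev del: of_nat_mult)
  finally show ?thesis
    unfolding G_coeff_def using G_coeff_ex1 [of l n] by (intro the1_equality) simp_all
qed

text \<open>
  Replacing \<open>s\<^sup>n\<close> by \<open>1/((z-1)\<dots>(z-n))\<close> turns \<open>s\<^sup>i y\<^sub>i(s)\<close> into \<open>1/((z-2)\<dots>(z-2i))\<close>. Multiplying the
  series for \<open>i + 1\<close> by \<open>z - 2(i+1)\<close> must give the series for \<open>i\<close>. On the term with last factor
  \<open>z - n\<close>, where \<open>n = i + 1 + m\<close>, write \<open>z - 2(i+1) = (z - n) - (i + 1 - m)\<close>: the first part cancels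
  the last factor, and the coefficients recombine by \<open>bessel_coeff_Suc_Suc\<close>.
\<close>
lemma sum_bessel_coeff_factorial_series:
  fixes z :: "'a :: field"
  assumes z: "\<And>n. z \<noteq> of_nat n"
  shows "(\<Sum>m\<le>i. of_nat (bessel_coeff i m) / (\<Prod>j=1..i + m. z - of_nat j)) =
    1 / (\<Prod>j=1..i. z - of_nat (2 * j))"
proof (induction i)
  case (Suc i)
  let ?D = "\<lambda>n. \<Prod>j=1..n. z - of_nat j" and ?b = "\<lambda>i m. of_nat (bessel_coeff i m) :: 'a"
  have D_ne: "?D n \<noteq> 0" for n
    using z by (auto simp: prod_zero_iff)
  have split: "(z - of_nat (2 * Suc i)) * (?b (Suc i) m / ?D (Suc i + m)) =
      ?b (Suc i) m / ?D (i + m) - of_nat ((Suc i - m) * bessel_coeff (Suc i) m) / ?D (i + Suc m)"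
    if "m \<le> Suc i" for m
  proof -
    have cancel: "(w - c) * (b / (D * w)) = b / D - c * b / (D * w)"
      if "w \<noteq> 0" "D \<noteq> 0" for w c b D :: 'a
      using that by (simp add: divide_simps) (simp add: algebra_simps)
    have "z - of_nat (2 * Suc i) = (z - of_nat (Suc (i + m))) - of_nat (Suc i - m)"
      using that by (simp add: of_nat_diff)
    moreover have "?D (Suc i + m) = ?D (i + m) * (z - of_nat (Suc (i + m)))"
      "?D (i + Suc m) = ?D (i + m) * (z - of_nat (Suc (i + m)))"
      by simp_all
    moreover have "z - of_nat (Suc (i + m)) \<noteq> 0"
      using z [of "Suc (i + m)"] by simp
    ultimately show ?thesis
      using D_ne [of "i + m"] by (simp only: of_nat_mult cancel not_False_eq_True)
  qed
  have "(z - of_nat (2 * Suc i)) * (\<Sum>m\<le>Suc i. ?b (Suc i) m / ?D (Suc i + m)) =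
      (\<Sum>m\<le>Suc i. ?b (Suc i) m / ?D (i + m)) -
      (\<Sum>m\<le>Suc i. of_nat ((Suc i - m) * bessel_coeff (Suc i) m) / ?D (i + Suc m))"
    unfolding sum_distrib_left sum_subtractf [symmetric] by (intro sum.cong [OF refl] split) simp
  also have "(\<Sum>m\<le>Suc i. of_nat ((Suc i - m) * bessel_coeff (Suc i) m) / ?D (i + Suc m)) =
      (\<Sum>m\<le>i. of_nat ((Suc i - m) * bessel_coeff (Suc i) m) / ?D (i + Suc m))"
    by simp
  also have "(\<Sum>m\<le>Suc i. ?b (Suc i) m / ?D (i + m)) =
      1 / ?D i + (\<Sum>m\<le>i. ?b (Suc i) (Suc m) / ?D (i + Suc m))"
    unfolding sum.atMost_Suc_shift by simp
  also have "(\<Sum>m\<le>i. ?b (Suc i) (Suc m) / ?D (i + Suc m)) =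
      (\<Sum>m\<le>i. of_nat ((Suc i - m) * bessel_coeff (Suc i) m) / ?D (i + Suc m)) +
      (\<Sum>m\<le>i. ?b i (Suc m) / ?D (i + Suc m))"
    unfolding sum.distrib [symmetric] add_divide_distrib [symmetric] of_nat_add [symmetric]
    by (intro sum.cong [OF refl]) (simp add: bessel_coeff_Suc_Suc)
  also have "1 / ?D i + (\<dots>) - (\<Sum>m\<le>i. of_nat ((Suc i - m) * bessel_coeff (Suc i) m) / ?D (i + Suc m)) =
      1 / ?D i + (\<Sum>m\<le>i. ?b i (Suc m) / ?D (i + Suc m))"
    by simp
  also have "\<dots> = (\<Sum>m\<le>Suc i. ?b i m / ?D (i + m))"
    unfolding sum.atMost_Suc_shift by simp
  also have "\<dots> = 1 / (\<Prod>j=1..i. z - of_nat (2 * j))"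
    using Suc.IH by simp
  finally have *: "(z - of_nat (2 * Suc i)) * (\<Sum>m\<le>Suc i. ?b (Suc i) m / ?D (Suc i + m)) =
    1 / (\<Prod>j=1..i. z - of_nat (2 * j))" .
  have "z - of_nat (2 * Suc i) \<noteq> 0"
    using z [of "2 * Suc i"] by simp
  then have "(\<Sum>m\<le>Suc i. ?b (Suc i) m / ?D (Suc i + m)) =
      1 / (\<Prod>j=1..i. z - of_nat (2 * j)) / (z - of_nat (2 * Suc i))"
    unfolding * [symmetric] by (rule nonzero_mult_div_cancel_left [symmetric])
  moreover have "(\<Prod>j=1..Suc i. z - of_nat (2 * j)) = (\<Prod>j=1..i. z - of_nat (2 * j)) * (z - of_nat (2 * Suc i))"
    by simp
  ultimately show ?case
    by (simp only: divide_divide_eq_left)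
qed simp

text \<open>
  Grouping the double sum for \<^const>\<open>F_rat\<close> by the exponent \<open>i = n - m\<close> of \<open>\<varpi>\<close> produces one inverse
  factorial series for each \<open>i\<close>. The factors \<open>Z - 2j\<close> with \<open>j \<le> i\<close> then cancel against the denominator
  that defines the numerator.
\<close>
lemma P_num_eq:
  "P_num l = to_fract (\<Sum>i\<le>l. [:monom (of_nat (bessel_coeff l i)) i:] *
     (\<Prod>j\<in>{i<..l}. [:- of_nat (2 * j), 1:]))"
proof -
  define z :: "rat poly poly fract" where "z = to_fract [:0, 1:]"
  define c where "c i = (to_fract [:monom (of_nat (bessel_coeff l i)) i:] :: rat poly poly fract)" for i
  have of_nat: "to_fract (of_nat k) = of_nat k" for k :: nat
    by (induction k) simp_all
  have lin: "to_fract [:- of_nat k, 1:] = z - of_nat k" for k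
  proof -
    have "[:- of_nat k, 1:] = [:0, 1:] - (of_nat k :: rat poly poly)"
      by (simp add: of_nat_poly)
    then show ?thesis
      by (simp only: to_fract_diff z_def of_nat)
  qed
  have to_fract_prod: "to_fract (prod f A) = (\<Prod>i\<in>A. to_fract (f i))"
    for f :: "nat \<Rightarrow> rat poly poly" and A
    by (induction A rule: infinite_finite_induct) simp_all
  have z: "z \<noteq> of_nat k" for k
  proof
    assume "z = of_nat k"
    then have "to_fract [:- of_nat k, 1:] = (0 :: rat poly poly fract)"
      by (simp add: lin)
    then show False
      by (simp only: to_fract_eq_0_iff) simp
  qed
  let ?D = "\<lambda>n. \<Prod>j=1..n. z - of_nat j" and ?E = "\<lambda>A. \<Prod>j\<in>A. z - of_nat (2 * j)"
  have E_ne: "?E A \<noteq> 0" for A :: "nat set"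
    using z by (cases "finite A") (simp_all add: prod_zero_iff del: of_nat_mult)
  have G: "to_fract [:G_coeff l n:] = (\<Sum>m\<le>n div 2. c (n - m) * of_nat (bessel_coeff (n - m) m))" for n
  proof -
    have "[:G_coeff l n:] = (\<Sum>m\<le>n div 2. [:monom (of_nat (bessel_coeff l (n - m))) (n - m):] * 
        of_nat (bessel_coeff (n - m) m))"
    proof -
      have "[:sum f A:] = (\<Sum>i\<in>A. [:f i:])" for f :: "nat \<Rightarrow> rat poly" and A
      proof (induction A rule: infinite_finite_induct)
        case (insert x A)
        have "[:f x + sum f A:] = [:f x:] + [:sum f A:]"
          by simp
        then show ?case
          using insert by simp
      qed simp_all
      then show ?thesis
        by (simp add: G_coeff_eq of_nat_poly smult_monom mult.commute)
    qed
    then show ?thesis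
      by (simp only: to_fract_sum to_fract_mult of_nat c_def)
  qed
  define f where "f i m = c i * of_nat (bessel_coeff i m) / ?D (i + m)" for i m
  have f_eq_0: "f i m = 0" if "l < i" for i m
    using that by (simp add: f_def c_def)
  have "F_rat l = (\<Sum>n\<le>2 * l. \<Sum>m\<le>n div 2. f (n - m) m)"
    unfolding F_rat_def to_fract_prod lin G sum_divide_distrib
    by (intro sum.cong refl) (simp add: f_def)
  also have "\<dots> = (\<Sum>(i, m)\<in>{(i, m). m \<le> i \<and> i + m \<le> 2 * l}. f i m)"
    unfolding sum.Sigma [OF finite_atMost ballI [OF finite_atMost]]
    by (rule sum.reindex_bij_witness [where j = "\<lambda>(n, m). (n - m, m)" and i = "\<lambda>(i, m). (i + m, m)"]) auto
  also have "\<dots> = (\<Sum>(i, m)\<in>(SIGMA i:{..l}. {..i}). f i m)"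
  proof (rule sum.mono_neutral_right)
    show "finite {(i, m). m \<le> i \<and> i + m \<le> 2 * l}"
      by (rule finite_subset [of _ "{..2 * l} \<times> {..2 * l}"]) auto
  qed (auto intro: f_eq_0)
  also have "\<dots> = (\<Sum>i\<le>l. \<Sum>m\<le>i. f i m)"
    by (simp add: sum.Sigma)
  also have "\<dots> = (\<Sum>i\<le>l. c i * (\<Sum>m\<le>i. of_nat (bessel_coeff i m) / ?D (i + m)))"
    by (simp only: f_def sum_distrib_left times_divide_eq_right)
  also have "\<dots> = (\<Sum>i\<le>l. c i * (1 / ?E {1..i}))"
    unfolding sum_bessel_coeff_factorial_series [OF z] ..
  finally have "P_num l = (\<Sum>i\<le>l. c i * (1 / ?E {1..i}) * ?E {1..l})"
    unfolding P_num_def to_fract_prod lin by (simp add: sum_distrib_right)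
  also have "\<dots> = (\<Sum>i\<le>l. c i * ?E {i<..l})"
  proof (rule sum.cong [OF refl])
    fix i assume "i \<in> {..l}"
    then have "{1..l} = {1..i} \<union> {i<..l}"
      by auto
    then have "?E {1..l} = ?E {1..i} * ?E {i<..l}"
      by (simp only:, intro prod.union_disjoint) auto
    then show "c i * (1 / ?E {1..i}) * ?E {1..l} = c i * ?E {i<..l}"
      using E_ne [of "{1..i}"] by simp
  qed
  finally show ?thesis
    by (simp only: to_fract_sum to_fract_mult to_fract_prod lin c_def)
qed

section \<open>The coefficient of a power of \<open>\<varpi> - 2\<close>\<close>

definition even_prod :: "nat \<Rightarrow> nat \<Rightarrow> nat \<Rightarrow> 'a :: comm_ring_1 \<Rightarrow> 'a" where
  "even_prod k r d z = (\<Prod>j\<in>{r<..d}. z - of_nat (2 * (k + j)))"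

lemma even_prod_same [simp]: "even_prod k d d z = 1"
  by (simp add: even_prod_def)

lemma even_prod_Suc_right:
  assumes "r \<le> d"
  shows "even_prod k r (Suc d) z = (z - of_nat (2 * (k + Suc d))) * even_prod k r d z"
proof -
  have "{r<..Suc d} = insert (Suc d) {r<..d}"
    using assms by auto
  then show ?thesis
    by (simp add: even_prod_def algebra_simps)
qed

lemma even_prod_Suc_left:
  assumes "r < d"
  shows "even_prod k r d z = (z - of_nat (2 * (k + Suc r))) * even_prod k (Suc r) d z"
proof -
  have "{r<..d} = insert (Suc r) {Suc r<..d}"
    using assms by auto
  then show ?thesis
    by (simp add: even_prod_def algebra_simps)
qed

lemma even_prod_shift: "even_prod (k + i) r d z = even_prod k (r + i) (d + i) z"
  unfolding even_prod_def
  by (rule prod.reindex_bij_witness [where i = "\<lambda>j. j - i" and j = "\<lambda>j. j + i"]) auto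

definition mid_coeff :: "nat \<Rightarrow> nat \<Rightarrow> nat \<Rightarrow> nat" where
  "mid_coeff d e r = (d choose r) * pochhammer (Suc e) r"

text \<open>
  The polynomial in \<open>z\<close> multiplying \<open>b\<^sub>l\<^sub>,\<^sub>k u\<^sup>k\<close> when the expansion of \<open>P\<^sub>l\<close> is rewritten in \<open>u = \<varpi> - 2\<close>
  and \<open>d = l - k\<close>; see \<open>sum_bessel_coeff_shift\<close>. The second argument of \<^const>\<open>mid_coeff\<close> is \<open>l + k\<close>.
\<close>
definition mid_sum :: "nat \<Rightarrow> nat \<Rightarrow> 'a :: comm_ring_1 \<Rightarrow> 'a" where
  "mid_sum d k z = (\<Sum>r\<le>d. of_nat (mid_coeff d (2 * k + d) r) * even_prod k r d z)"

lemma mid_coeff_0 [simp]: "mid_coeff d e 0 = 1"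
  and mid_coeff_eq_0 [simp]: "d < r \<Longrightarrow> mid_coeff d e r = 0"
  by (simp_all add: mid_coeff_def)

text \<open>
  The comparison of coefficients behind \<open>mid_sum_rec\<close>. All four terms are multiples of
  \<open>binom(d+2, r+2)\<close> times the rising factorial of length \<open>r\<close> starting at \<open>e + 3\<close>, and the remaining
  factors are quadratic in \<open>e\<close> and \<open>r\<close>.
\<close>
lemma mid_coeff_contiguous:
  "int (mid_coeff (d + 2) (e + 2) (r + 2)) - 2 * (int d + 1 - int r) * int (mid_coeff (d + 2) (e + 2) (r + 1)) =
   int (mid_coeff (d + 2) e (r + 2)) - (int d + 2) * (int d + 1) * int (mid_coeff d (e + 2) r)"
proof -
  define P where "P = int (pochhammer (e + 3) r)"
  define C where "C = int ((d + 2) choose (r + 2))"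
  have p1: "int (pochhammer (e + 3) (r + 2)) = P * (int e + r + 3) * (int e + r + 4)"
    "int (pochhammer (e + 3) (r + 1)) = P * (int e + r + 3)"
  proof -
    have "pochhammer (e + 3) (Suc (Suc r)) = pochhammer (e + 3) r * (e + 3 + r) * (e + 3 + Suc r)"
      "pochhammer (e + 3) (Suc r) = pochhammer (e + 3) r * (e + 3 + r)"
      by (simp_all only: pochhammer_Suc of_nat_id)
    then show "int (pochhammer (e + 3) (r + 2)) = P * (int e + r + 3) * (int e + r + 4)"
      "int (pochhammer (e + 3) (r + 1)) = P * (int e + r + 3)"
      by (simp_all add: P_def add_ac)
  qed
  have p2: "int (pochhammer (e + 1) (r + 2)) = (int e + 1) * (int e + 2) * P"
  proof -
    have "pochhammer (e + 1) (Suc (Suc r)) = (e + 1) * ((e + 1 + 1) * pochhammer (e + 1 + 1 + 1) r)"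
      by (simp only: pochhammer_rec)
    moreover have "e + 1 + 1 + 1 = e + 3" "Suc (Suc r) = r + 2"
      by simp_all
    ultimately have "int (pochhammer (e + 1) (r + 2)) = int (e + 1) * (int (e + 1 + 1) * P)"
      by (simp only: P_def of_nat_mult)
    then show ?thesis
      by (simp add: mult.assoc add.commute)
  qed
  have c1: "(int d + 1 - int r) * int ((d + 2) choose (r + 1)) = (int r + 2) * C"
  proof (cases "r \<le> d + 1")
    case True
    have "Suc (r + 1) * ((d + 2) choose Suc (r + 1)) = (d + 2 - (r + 1)) * ((d + 2) choose (r + 1))"
      by (rule Suc_times_choose_Suc)
    from arg_cong [OF this, of int]
    have "int (Suc (r + 1)) * int ((d + 2) choose Suc (r + 1)) = int (d + 2 - (r + 1)) * int ((d + 2) choose (r + 1))"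
      by (simp only: of_nat_mult)
    moreover have "int (Suc (r + 1)) = int r + 2" "int (d + 2 - (r + 1)) = int d + 1 - int r" "Suc (r + 1) = r + 2"
      using True by simp_all
    ultimately show ?thesis
      by (simp only: C_def)
  qed (simp add: C_def binomial_eq_0)
  have c2: "(int d + 2) * (int d + 1) * int (d choose r) = (int r + 2) * (int r + 1) * C"
  proof -
    define X where "X = int (Suc d choose Suc r)"
    have X: "(int r + 2) * C = (int d + 2) * X" "(int r + 1) * X = (int d + 1) * int (d choose r)"
      using arg_cong [OF Suc_times_binomial [of "Suc r" "Suc d"], of int]
        arg_cong [OF Suc_times_binomial [of r d], of int]
      by (simp_all add: C_def X_def algebra_simps del: binomial_Suc_Suc)
    have "(int r + 2) * (int r + 1) * C = (int r + 1) * ((int r + 2) * C)"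
      by (simp only: mult_ac)
    also have "\<dots> = (int d + 2) * ((int r + 1) * X)"
      unfolding X(1) by (simp only: mult_ac)
    also have "\<dots> = (int d + 2) * (int d + 1) * int (d choose r)"
      unfolding X(2) by (simp only: mult_ac)
    finally show ?thesis ..
  qed
  have arg: "Suc (e + 2) = e + 3" "Suc e = e + 1"
    by simp_all
  have "int (mid_coeff (d + 2) (e + 2) (r + 2)) - 2 * (int d + 1 - int r) * int (mid_coeff (d + 2) (e + 2) (r + 1)) =
      C * (P * (int e + r + 3) * (int e + r + 4)) -
      2 * ((int d + 1 - int r) * int ((d + 2) choose (r + 1))) * (P * (int e + r + 3))"
    unfolding mid_coeff_def of_nat_mult arg p1 C_def by (simp only: mult_ac)
  also have "\<dots> = C * ((int e + 1) * (int e + 2) * P) - ((int r + 2) * (int r + 1) * C) * P"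
    unfolding c1 by (simp add: algebra_simps)
  also have "\<dots> = int (mid_coeff (d + 2) e (r + 2)) - (int d + 2) * (int d + 1) * int (mid_coeff d (e + 2) r)"
    unfolding mid_coeff_def of_nat_mult arg p2 by (simp only: mult.assoc [symmetric] c2) (simp only: C_def P_def)
  finally show ?thesis .
qed

lemma mid_sum_0 [simp]: "mid_sum 0 k z = 1"
  by (simp add: mid_sum_def)

lemma mid_sum_1 [simp]: "mid_sum (Suc 0) k z = z"
  by (simp add: mid_sum_def mid_coeff_def even_prod_Suc_left algebra_simps)

text \<open>
  Increasing \<open>k\<close> shifts the window of factors \<open>z - 2(k+j)\<close> by one. Exchanging the factor that enters
  at the top for the one that leaves at the bottom changes it by a constant, so every product on the
  left is a combination of two products with the old \<open>k\<close>. In \<open>mid_sum d (k + 2)\<close> the window already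
  is a final segment of the old one, starting two places later.
\<close>
lemma mid_sum_rec:
  "mid_sum (d + 2) (Suc k) z =
     mid_sum (d + 2) k z - of_nat ((d + 2) * (d + 1)) * mid_sum d (k + 2) z"
proof -
  define e where "e = 2 * k + d + 2"
  let ?E = "\<lambda>r. even_prod k r (d + 2) z" and ?c = "\<lambda>d e r. of_int (int (mid_coeff d e r)) :: 'a"
  have shift: "even_prod (Suc k) r (d + 2) z = ?E r - of_int (2 * (int d + 2 - int r)) * ?E (Suc r)" 
    if "r < d + 2" for r
  proof -
    have "even_prod (Suc k) r (d + 2) z = even_prod k (Suc r) (Suc (d + 2)) z"
      using even_prod_shift [of k 1] by simp
    also have "\<dots> = (z - of_nat (2 * (k + Suc (d + 2)))) * ?E (Suc r)"
      using that by (intro even_prod_Suc_right) simp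
    also have "\<dots> = (z - of_nat (2 * (k + Suc r))) * ?E (Suc r) -
        of_int (2 * (int d + 2 - int r)) * ?E (Suc r)"
      by (simp add: algebra_simps)
    also have "(z - of_nat (2 * (k + Suc r))) * ?E (Suc r) = ?E r"
      using that by (intro even_prod_Suc_left [symmetric])
    finally show ?thesis .
  qed
  \<comment> \<open>At \<open>r = d + 2\<close> the window is empty on both sides and nothing has to be exchanged.\<close>
  have "mid_sum (d + 2) (Suc k) z = (\<Sum>r\<le>d + 2. ?c (d + 2) (e + 2) r * even_prod (Suc k) r (d + 2) z)"
    by (simp add: mid_sum_def e_def algebra_simps)
  also have "\<dots> = (\<Sum>r\<le>d + 2. ?c (d + 2) (e + 2) r * ?E r -
      (if r < d + 2 then of_int (2 * (int d + 2 - int r) * int (mid_coeff (d + 2) (e + 2) r)) * ?E (Suc r) else 0))"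
  proof (rule sum.cong [OF refl])
    fix r assume "r \<in> {..d + 2}"
    then consider "r < d + 2" | "r = d + 2" by fastforce
    then show "?c (d + 2) (e + 2) r * even_prod (Suc k) r (d + 2) z = ?c (d + 2) (e + 2) r * ?E r -
      (if r < d + 2 then of_int (2 * (int d + 2 - int r) * int (mid_coeff (d + 2) (e + 2) r)) * ?E (Suc r) else 0)"
    proof cases
      case 1
      then show ?thesis
        unfolding shift [OF 1] by (simp add: right_diff_distrib mult_ac del: add_2_eq_Suc')
    qed simp
  qed
  also have "\<dots> = (\<Sum>r\<le>d + 2. ?c (d + 2) (e + 2) r * ?E r) -
      (\<Sum>r\<le>d + 1. of_int (2 * (int d + 2 - int r) * int (mid_coeff (d + 2) (e + 2) r)) * ?E (Suc r))"
    by (simp add: sum_subtractf numeral_2_eq_2)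
  also have "(\<Sum>r\<le>d + 2. ?c (d + 2) (e + 2) r * ?E r) = ?E 0 + ?c (d + 2) (e + 2) 1 * ?E 1 +
      (\<Sum>r\<le>d. ?c (d + 2) (e + 2) (r + 2) * ?E (r + 2))"
    by (simp add: numeral_2_eq_2 sum.atMost_Suc_shift del: sum.atMost_Suc)
  also have "(\<Sum>r\<le>d + 1. of_int (2 * (int d + 2 - int r) * int (mid_coeff (d + 2) (e + 2) r)) * ?E (Suc r)) =
      of_int (2 * (int d + 2)) * ?E 1 +
      (\<Sum>r\<le>d. of_int (2 * (int d + 1 - int r) * int (mid_coeff (d + 2) (e + 2) (r + 1))) * ?E (r + 2))"
    by (simp add: numeral_2_eq_2 sum.atMost_Suc_shift del: sum.atMost_Suc) (simp add: add_ac add_diff_eq)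
  also have "?E 0 + ?c (d + 2) (e + 2) 1 * ?E 1 + (\<Sum>r\<le>d. ?c (d + 2) (e + 2) (r + 2) * ?E (r + 2)) - (\<dots>) =
      ?E 0 + ?c (d + 2) e 1 * ?E 1 + (\<Sum>r\<le>d. ?c (d + 2) (e + 2) (r + 2) * ?E (r + 2) - 
        of_int (2 * (int d + 1 - int r) * int (mid_coeff (d + 2) (e + 2) (r + 1))) * ?E (r + 2))"
  proof -
    have "?c (d + 2) (e + 2) 1 = ?c (d + 2) e 1 + of_int (2 * (int d + 2))"
      by (simp add: mid_coeff_def algebra_simps)
    then have "?c (d + 2) (e + 2) 1 * ?E 1 = ?c (d + 2) e 1 * ?E 1 + of_int (2 * (int d + 2)) * ?E 1"
      by (simp only: distrib_right)
    then show ?thesis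
      unfolding sum_subtractf by (simp only: diff_add_eq_diff_diff_swap add_diff_eq) (simp only: algebra_simps)
  qed
  also have "\<dots> = ?E 0 + ?c (d + 2) e 1 * ?E 1 + (\<Sum>r\<le>d. ?c (d + 2) e (r + 2) * ?E (r + 2) - 
        of_nat ((d + 2) * (d + 1)) * (?c d (e + 2) r * ?E (r + 2)))"
  proof -
    have "?c (d + 2) (e + 2) (r + 2) - of_int (2 * (int d + 1 - int r) * int (mid_coeff (d + 2) (e + 2) (r + 1))) =
      ?c (d + 2) e (r + 2) - of_nat ((d + 2) * (d + 1)) * ?c d (e + 2) r" for r
      using arg_cong [OF mid_coeff_contiguous [of d e r], of "of_int :: int \<Rightarrow> 'a"] by (simp add: algebra_simps)
    then show ?thesis
      unfolding left_diff_distrib [symmetric] mult.assoc [symmetric] by simp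
  qed
  also have "\<dots> = (?E 0 + ?c (d + 2) e 1 * ?E 1 + (\<Sum>r\<le>d. ?c (d + 2) e (r + 2) * ?E (r + 2))) - 
        of_nat ((d + 2) * (d + 1)) * (\<Sum>r\<le>d. ?c d (e + 2) r * ?E (r + 2))"
    unfolding sum_subtractf sum_distrib_left by simp
  also have "?E 0 + ?c (d + 2) e 1 * ?E 1 + (\<Sum>r\<le>d. ?c (d + 2) e (r + 2) * ?E (r + 2)) = mid_sum (d + 2) k z"
    by (simp add: mid_sum_def e_def numeral_2_eq_2 sum.atMost_Suc_shift del: sum.atMost_Suc)
  also have "(\<Sum>r\<le>d. ?c d (e + 2) r * ?E (r + 2)) = mid_sum d (k + 2) z"
    unfolding mid_sum_def even_prod_shift e_def by (simp add: algebra_simps)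
  finally show ?thesis .
qed

text \<open>
  The comparison of coefficients behind \<open>mid_sum_midpoint\<close>. After multiplication by \<open>r + 1\<close> both sides
  become \<open>(d+1+r)(d+2+r) binom(d,r) (d+1)\<dots>(d+r)\<close>, by the ratio of consecutive coefficients. At the
  boundary \<open>r = d + 1\<close> both sides are zero.
\<close>
lemma mid_coeff_midpoint:
  assumes "r \<le> Suc d"
  shows "int (mid_coeff (d + 2) (d + 2) (Suc r)) - 2 * (int d + 2 - int r) * int (mid_coeff (d + 2) (d + 2) r) =
    int (mid_coeff d d (Suc r)) + 2 * (int d + int r + 1) * int (mid_coeff d d r)"
proof -
  define A where "A = int (mid_coeff (d + 2) (d + 2) r)"
  define B where "B = int (mid_coeff d d r)"
  have Suc: "int (Suc r) * int (mid_coeff n n (Suc r)) = (int n - int r) * (int n + int r + 1) * int (mid_coeff n n r)"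
    if "r \<le> n" for n
  proof -
    have "Suc r * mid_coeff n n (Suc r) = (Suc r * (n choose Suc r)) * (pochhammer (Suc n) r * (Suc n + r))"
      by (simp only: mid_coeff_def pochhammer_Suc mult_ac of_nat_id)
    also have "\<dots> = (n - r) * (n + r + 1) * mid_coeff n n r"
      unfolding Suc_times_choose_Suc
      by (simp only: mid_coeff_def mult_ac add_ac Suc_eq_plus1)
    finally have "int (Suc r) * int (mid_coeff n n (Suc r)) = int (n - r) * int (n + r + 1) * int (mid_coeff n n r)"
      unfolding of_nat_mult [symmetric] by simp
    moreover have "int (n - r) = int n - int r" "int (n + r + 1) = int n + int r + 1"
      using that by simp_all
    ultimately show ?thesis
      by (simp only:)
  qed
  have AB: "(int d + 2 - int r) * (int d + 1 - int r) * A = (int d + 1 + int r) * (int d + 2 + int r) * B"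
  proof -
    define C where "C = (d + 2) choose r"
    define P where "P = pochhammer (d + 3) r"
    have c: "(d + 2 - r) * ((d + 1 - r) * C) = (d + 2) * ((d + 1) * (d choose r))"
    proof -
      have "(d + 2 - r) * ((d + 1 - r) * C) = (d + 1 - r) * ((d + 2 - r) * C)"
        by (simp only: mult_ac)
      also have "(d + 2 - r) * C = (d + 2) * ((d + 1) choose r)"
        using binomial_absorb_comp [of "d + 2" r] by (simp add: C_def)
      also have "(d + 1 - r) * \<dots> = (d + 2) * ((d + 1 - r) * ((d + 1) choose r))"
        by (simp only: mult_ac)
      also have "\<dots> = (d + 2) * ((d + 1) * (d choose r))"
        using binomial_absorb_comp [of "d + 1" r] by simp
      finally show ?thesis .
    qed
    have p: "(d + 1) * (d + 2) * P = pochhammer (d + 1) r * ((d + 1 + r) * (d + 2 + r))"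
      using pochhammer_product' [of "d + 1" 2 r] pochhammer_product' [of "d + 1" r 2]
      by (simp add: P_def numeral_2_eq_2 numeral_3_eq_3 pochhammer_rec add_ac)
    have "(d + 2) * (d + 1) * ((d + 2 - r) * (d + 1 - r) * (C * P)) =
        ((d + 2 - r) * ((d + 1 - r) * C)) * ((d + 1) * (d + 2) * P)"
      by (simp only: mult_ac)
    also have "\<dots> = (d + 2) * (d + 1) * ((d + 1 + r) * (d + 2 + r) * ((d choose r) * pochhammer (d + 1) r))"
      unfolding c p by (simp only: mult_ac)
    finally have "(d + 2) * (d + 1) * ((d + 2 - r) * (d + 1 - r) * mid_coeff (d + 2) (d + 2) r) =
        (d + 2) * (d + 1) * ((d + 1 + r) * (d + 2 + r) * mid_coeff d d r)"
      by (simp add: mid_coeff_def C_def P_def numeral_3_eq_3)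
    then have "(d + 2 - r) * (d + 1 - r) * mid_coeff (d + 2) (d + 2) r = (d + 1 + r) * (d + 2 + r) * mid_coeff d d r"
      by (simp only: mult_cancel_left) simp
    from arg_cong [OF this, of int]
    have "int (d + 2 - r) * int (d + 1 - r) * A = int (d + 1 + r) * int (d + 2 + r) * B"
      by (simp only: of_nat_mult A_def B_def)
    moreover have "int (d + 2 - r) = int d + 2 - int r" "int (d + 1 - r) = int d + 1 - int r"
      "int (d + 1 + r) = int d + 1 + int r" "int (d + 2 + r) = int d + 2 + int r"
      using assms by simp_all
    ultimately show ?thesis
      by (simp only:)
  qed
  show ?thesis
  proof (cases "r \<le> d")
    case True
    have "int (Suc r) * (int (mid_coeff (d + 2) (d + 2) (Suc r)) - 2 * (int d + 2 - int r) * A) =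
        (int d + 2 - int r) * (int d + 1 - int r) * A"
      using Suc [of "d + 2"] True by (simp add: right_diff_distrib A_def) (simp add: algebra_simps)
    also have "\<dots> = int (Suc r) * (int (mid_coeff d d (Suc r)) + 2 * (int d + int r + 1) * B)"
      unfolding AB using Suc [of d] True by (simp add: distrib_left B_def) (simp add: algebra_simps)
    finally show ?thesis
      unfolding mult_cancel_left A_def B_def by simp
  next
    case False
    then have r: "r = Suc d"
      using assms by simp
    show ?thesis
      using Suc [of "d + 2"] by (simp add: r mid_coeff_def pochhammer_Suc binomial_eq_0 algebra_simps)
  qed
qed

text \<open>
  Both sides are expanded in the products \<open>(z - 2(r+1))\<dots>(z - 2(d+1))\<close> for \<open>0 \<le> r \<le> d + 1\<close>. On the
  right, the factor \<open>z - 2(d+1)\<close> lengthens each product at the top, and \<open>z + 2(d+1)\<close> is split as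
  \<open>(z - 2r) + 2(d+1+r)\<close>, which lengthens it at the bottom. On the left, the top factor
  \<open>z - 2(d+2)\<close> is replaced by \<open>z - 2r\<close> in the same way. For \<open>r = 0\<close> the new factor is \<open>z\<close> itself, which
  gives the same term \<open>z (z - 2)\<dots>(z - 2(d+1))\<close> on both sides.
\<close>
lemma mid_sum_midpoint:
  "mid_sum (d + 2) 0 z = (z\<^sup>2 - of_nat ((2 * (d + 1))\<^sup>2)) * mid_sum d 0 z"
proof -
  let ?E = "\<lambda>r. even_prod 0 r (Suc d) z" and ?c = "\<lambda>d r. of_int (int (mid_coeff d d r)) :: 'a"
  have left: "even_prod 0 (Suc r) (d + 2) z = ?E r - of_int (2 * (int d + 1 - int r)) * ?E (Suc r)"
    if "r \<le> Suc d" for r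
  proof (cases "r = Suc d")
    case False
    then have "r < Suc d"
      using that by simp
    have "even_prod 0 (Suc r) (d + 2) z = (z - of_nat (2 * (0 + Suc (Suc d)))) * ?E (Suc r)"
      using even_prod_Suc_right [of "Suc r" "Suc d" 0 z] \<open>r < Suc d\<close> by simp
    also have "\<dots> = (z - of_nat (2 * (0 + Suc r))) * ?E (Suc r) - of_int (2 * (int d + 1 - int r)) * ?E (Suc r)"
      by (simp add: algebra_simps)
    also have "(z - of_nat (2 * (0 + Suc r))) * ?E (Suc r) = ?E r"
      using \<open>r < Suc d\<close> by (intro even_prod_Suc_left [symmetric])
    finally show ?thesis .
  qed simp
  have right: "(z\<^sup>2 - of_nat ((2 * (d + 1))\<^sup>2)) * even_prod 0 r d z = (z + of_nat (2 * (d + 1))) * ?E r"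
    if "r \<le> d" for r
    using that by (simp add: even_prod_Suc_right algebra_simps power2_eq_square)
  have right': "(z + of_nat (2 * (d + 1))) * ?E (Suc r) = ?E r + of_int (2 * (int d + int r + 2)) * ?E (Suc r)"
    if "r \<le> d" for r
  proof -
    have "(z + of_nat (2 * (d + 1))) * ?E (Suc r) = (z - of_nat (2 * (0 + Suc r))) * ?E (Suc r) +
        of_int (2 * (int d + int r + 2)) * ?E (Suc r)"
      by (simp add: algebra_simps)
    also have "(z - of_nat (2 * (0 + Suc r))) * ?E (Suc r) = ?E r"
      using that by (intro even_prod_Suc_left [symmetric]) simp
    finally show ?thesis .
  qed
  have "mid_sum (d + 2) 0 z = even_prod 0 0 (d + 2) z +
      (\<Sum>r\<le>Suc d. ?c (d + 2) (Suc r) * even_prod 0 (Suc r) (d + 2) z)"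
    by (simp add: mid_sum_def sum.atMost_Suc_shift del: sum.atMost_Suc)
  also have "(\<Sum>r\<le>Suc d. ?c (d + 2) (Suc r) * even_prod 0 (Suc r) (d + 2) z) =
      (\<Sum>r\<le>Suc d. ?c (d + 2) (Suc r) * ?E r) -
      (\<Sum>r\<le>Suc d. of_int (2 * (int d + 1 - int r)) * ?c (d + 2) (Suc r) * ?E (Suc r))"
    unfolding sum_subtractf [symmetric] by (intro sum.cong [OF refl], subst left) (simp_all add: right_diff_distrib mult_ac)
  also have "(\<Sum>r\<le>Suc d. of_int (2 * (int d + 1 - int r)) * ?c (d + 2) (Suc r) * ?E (Suc r)) =
      (\<Sum>r\<le>d. of_int (2 * (int d + 2 - int (Suc r))) * ?c (d + 2) (Suc r) * ?E (Suc r))"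
    by (simp add: algebra_simps)
  also have "\<dots> = (\<Sum>r\<le>Suc d. of_int (2 * (int d + 2 - int r)) * ?c (d + 2) r * ?E r) - of_int (2 * (int d + 2)) * ?E 0"
    unfolding sum.atMost_Suc_shift by simp
  also have "even_prod 0 0 (d + 2) z = (z - of_int (2 * (int d + 2))) * ?E 0"
    using even_prod_Suc_right [of 0 "Suc d" 0 z] by (simp add: algebra_simps)
  finally have "mid_sum (d + 2) 0 z = z * ?E 0 + ((\<Sum>r\<le>Suc d. ?c (d + 2) (Suc r) * ?E r) -
      (\<Sum>r\<le>Suc d. of_int (2 * (int d + 2 - int r)) * ?c (d + 2) r * ?E r))"
    by (simp only: left_diff_distrib) simp
  also have "(\<Sum>r\<le>Suc d. ?c (d + 2) (Suc r) * ?E r) -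
      (\<Sum>r\<le>Suc d. of_int (2 * (int d + 2 - int r)) * ?c (d + 2) r * ?E r) =
      (\<Sum>r\<le>Suc d. of_int (int (mid_coeff d d (Suc r)) + 2 * (int d + int r + 1) * int (mid_coeff d d r)) * ?E r)"
    unfolding sum_subtractf [symmetric] left_diff_distrib [symmetric] of_int_mult [symmetric] of_int_diff [symmetric]
    by (intro sum.cong [OF refl]) (simp only: mid_coeff_midpoint atMost_iff)
  also have "\<dots> = (\<Sum>r\<le>d. ?c d (Suc r) * ?E r) + (\<Sum>r\<le>d. of_int (2 * (int d + int r + 1)) * ?c d r * ?E r)"
    by (simp add: sum.distrib distrib_right del: of_int_mult) simp
  also have "(\<Sum>r\<le>d. of_int (2 * (int d + int r + 1)) * ?c d r * ?E r) =
     of_int (2 * (int d + 1)) * ?E 0 + (\<Sum>r\<le>d. of_int (2 * (int d + int r + 2)) * ?c d (Suc r) * ?E (Suc r))"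
  proof -
    have "(\<Sum>r\<le>d. of_int (2 * (int d + int r + 1)) * ?c d r * ?E r) =
      (\<Sum>r\<le>Suc d. of_int (2 * (int d + int r + 1)) * ?c d r * ?E r)"
      by simp
    also have "\<dots> = of_int (2 * (int d + 1)) * ?E 0 + (\<Sum>r\<le>d. of_int (2 * (int d + int r + 2)) * ?c d (Suc r) * ?E (Suc r))"
      unfolding sum.atMost_Suc_shift by (simp add: algebra_simps)
    finally show ?thesis .
  qed
  also have "z * ?E 0 + ((\<Sum>r\<le>d. ?c d (Suc r) * ?E r) + (\<dots>)) =
      (z + of_nat (2 * (d + 1))) * ?E 0 + (\<Sum>r\<le>d. ?c d (Suc r) * ((z + of_nat (2 * (d + 1))) * ?E (Suc r)))"
  proof -
    have "(\<Sum>r\<le>d. ?c d (Suc r) * ((z + of_nat (2 * (d + 1))) * ?E (Suc r))) =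
        (\<Sum>r\<le>d. ?c d (Suc r) * ?E r) + (\<Sum>r\<le>d. of_int (2 * (int d + int r + 2)) * ?c d (Suc r) * ?E (Suc r))"
      unfolding sum.distrib [symmetric]
      by (intro sum.cong [OF refl], subst right') (simp_all add: distrib_left mult_ac)
    then show ?thesis
      by (simp add: distrib_right)
  qed
  also have "\<dots> = (\<Sum>r\<le>Suc d. ?c d r * ((z + of_nat (2 * (d + 1))) * ?E r))"
    unfolding sum.atMost_Suc_shift by simp
  also have "\<dots> = (\<Sum>r\<le>d. ?c d r * ((z + of_nat (2 * (d + 1))) * ?E r))"
    by simp
  also have "\<dots> = (z\<^sup>2 - of_nat ((2 * (d + 1))\<^sup>2)) * mid_sum d 0 z"
    unfolding mid_sum_def sum_distrib_left
    by (intro sum.cong [OF refl], subst right [symmetric]) (simp_all add: mult_ac)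
  finally show ?thesis .
qed

section \<open>The ballot sum of midpoint numerators\<close>

lemma ballot_0_left [simp]: "ballot 0 k = 1"
  by (simp add: ballot_def)

lemma ballot_0_right: "ballot j 0 = (if j = 0 then 1 else 0)"
  by (simp add: ballot_def)

text \<open>
  This is \<open>C\<^bsup>k+1\<^esup> = C\<^sup>k + y C\<^bsup>k+2\<^esup>\<close> for the Catalan series \<open>C = 1 + y C\<^sup>2\<close>, whose \<open>k\<close>-th power is the
  generating function of \<open>\<beta>\<^sub>j(k)\<close>. With everything over a common denominator, it reduces to
  \<open>k(j+k+2) + (k+2)(j+1) = (k+1)(2j+k+2)\<close>.
\<close>
lemma ballot_Suc: "ballot (Suc j) (Suc k) = ballot (Suc j) k + ballot j (k + 2)"
proof -
  define n where "n = 2 * j + k + 2"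
  have 1: "of_nat (n choose Suc j) = (fact n / (fact (Suc j) * fact (j + k + 1)) :: rat)"
    by (subst binomial_fact) (simp_all add: n_def)
  have 2: "of_nat (n choose j) = (fact n / (fact j * fact (j + k + 2)) :: rat)"
    by (subst binomial_fact) (simp_all add: n_def)
  have 3: "of_nat (Suc n choose Suc j) = (fact (Suc n) / (fact (Suc j) * fact (j + k + 2)) :: rat)"
    by (subst binomial_fact) (simp_all add: n_def)
  have b1: "ballot (Suc j) k = of_nat k / of_nat n * of_nat (n choose Suc j)"
    by (simp add: ballot_def n_def)
  have b2: "ballot j (k + 2) = of_nat (k + 2) / of_nat n * of_nat (n choose j)"
    by (cases "j = 0") (simp_all add: ballot_def n_def add_ac)
  have b3: "ballot (Suc j) (Suc k) = of_nat (Suc k) / of_nat (Suc n) * of_nat (Suc n choose Suc j)"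
    by (simp add: ballot_def n_def del: binomial_Suc_Suc)
  have f: "fact (Suc n) = (of_nat (Suc n) * fact n :: rat)"
    "fact (Suc j) = (of_nat (Suc j) * fact j :: rat)"
    "fact (j + k + 2) = (of_nat (j + k + 2) * fact (j + k + 1) :: rat)"
    by (simp_all add: numeral_2_eq_2 del: of_nat_Suc)
  have "(k * (j + k + 2) + (k + 2) * Suc j) = Suc k * n"
    by (simp add: n_def algebra_simps)
  from arg_cong [OF this, of of_nat]
  have key: "of_nat k * of_nat (j + k + 2) + of_nat (k + 2) * of_nat (Suc j) = (of_nat (Suc k) * of_nat n :: rat)"
    by (simp only: of_nat_mult of_nat_add)
  have pos: "of_nat n \<noteq> (0 :: rat)" "of_nat (Suc n) \<noteq> (0 :: rat)" "of_nat (Suc j) \<noteq> (0 :: rat)"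
     "of_nat (j + k + 2) \<noteq> (0 :: rat)"
    unfolding of_nat_eq_0_iff by (simp_all add: n_def)
  \<comment> \<open>Two field identities in plain variables; instantiating them avoids expanding factorials.\<close>
  have *: "k' / n' * (N / (j' * J * K)) + k2 / n' * (N / (J * (j2 * K))) =
      (k' * j2 + k2 * j') * N / (n' * j' * j2 * J * K)"
    if "n' \<noteq> 0" "j' \<noteq> 0" "j2 \<noteq> 0" "J \<noteq> 0" "K \<noteq> 0" for k' n' N j' J K k2 j2 :: rat
    using that by (simp add: divide_simps) (simp add: algebra_simps)
  have **: "k1 * n' * N / (n' * j' * j2 * J * K) = k1 / n1 * (n1 * N / (j' * J * (j2 * K)))"
    if "n' \<noteq> 0" "n1 \<noteq> 0" for k1 n' n1 N j' J K j2 :: rat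
    using that by (simp add: divide_simps) 
  show ?thesis
    unfolding b1 b2 b3 1 2 3 f * [OF pos(1,3,4) fact_nonzero fact_nonzero] key
    by (rule ** [OF pos(1,2), symmetric])
qed

lemma S_mid_0 [simp]: "S_mid 0 = 1"
  and S_mid_1 [simp]: "S_mid (Suc 0) = [:0, 1:]"
  by (simp_all add: S_mid_def monom_Suc one_pCons [symmetric])

text \<open>
  The even and the odd family obey the same rule: the new root is \<open>4m + 2\<close> for \<open>d = 2m\<close> and
  \<open>4(m+1)\<close> for \<open>d = 2m + 1\<close>, in both cases \<open>2(d+1)\<close>.
\<close>
lemma S_mid_rec: "S_mid (d + 2) = ([:0, 1:]\<^sup>2 - of_nat ((2 * (d + 1))\<^sup>2)) * S_mid d"
proof -
  have Z: "monom 1 2 = ([:0, 1:]\<^sup>2 :: rat poly poly)"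
    by (simp add: numeral_2_eq_2 monom_Suc power2_eq_square)
  show ?thesis
  proof (cases "even d")
    case True
    then obtain m where "d = 2 * m" ..
    then show ?thesis
      by (simp add: S_mid_def Z of_nat_poly algebra_simps)
  next
    case False
    then obtain m where d: "d = 2 * m + 1" ..
    have "(2 * (d + 1))\<^sup>2 = 16 * (Suc m)\<^sup>2"
      by (simp add: d power2_eq_square algebra_simps)
    then show ?thesis
      by (simp add: S_mid_def Z of_nat_poly d mult_ac del: of_nat_mult)
  qed
qed

lemma mid_sum_0_eq_S_mid: "mid_sum d 0 [:0, 1:] = S_mid d"
proof (induction d rule: induct_nat_012)
  case (ge2 d)
  then show ?case
    using mid_sum_midpoint [of d "[:0, 1:] :: rat poly poly"] S_mid_rec [of d] by simp
qed simp_all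

definition ballot_sum :: "nat \<Rightarrow> nat \<Rightarrow> rat poly poly" where
  "ballot_sum d k = (\<Sum>j\<le>d div 2.
     smult [:(-1) ^ j * (fact d / fact (d - 2 * j)) * ballot j k:] (S_mid (d - 2 * j)))"

text \<open>
  The ballot recursion applied termwise: the part \<open>\<beta>\<^sub>j(k+2)\<close> of \<open>\<beta>\<^bsub>j+1\<^esub>(k+1)\<close> reproduces the sum for
  \<open>d\<close>, and the sign and the ratio \<open>(d+2)!/d!\<close> give its factor.
\<close>
lemma ballot_sum_rec:
  "ballot_sum (d + 2) (Suc k) =
     ballot_sum (d + 2) k - of_nat ((d + 2) * (d + 1)) * ballot_sum d (k + 2)"
proof -
  let ?t = "\<lambda>d k j. smult [:(-1) ^ j * (fact d / fact (d - 2 * j)) * ballot j k:] (S_mid (d - 2 * j))"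
  have split: "ballot_sum (d + 2) k = S_mid (d + 2) + (\<Sum>j\<le>d div 2. ?t (d + 2) k (Suc j))" for k
    by (simp add: ballot_sum_def sum.atMost_Suc_shift one_pCons [symmetric] del: sum.atMost_Suc)
  have "?t (d + 2) (Suc k) (Suc j) = ?t (d + 2) k (Suc j) - of_nat ((d + 2) * (d + 1)) * ?t d (k + 2) j" for j
  proof -
    have "fact (d + 2) = (of_nat ((d + 2) * (d + 1)) * fact d :: rat)"
      by (simp add: algebra_simps)
    then have "(-1) ^ Suc j * (fact (d + 2) / fact (d - 2 * j)) * ballot j (k + 2) =
        - (of_nat ((d + 2) * (d + 1)) * ((-1) ^ j * (fact d / fact (d - 2 * j)) * ballot j (k + 2)))"
      by simp
    moreover have "d + 2 - 2 * Suc j = d - 2 * j"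
      by simp
    moreover have "smult [:a + b:] p = smult [:a:] p + smult [:b:] p" for a b :: rat and p
      by (simp flip: smult_add_left)
    moreover have "smult [:- (of_nat n * b):] p = - (of_nat n * smult [:b:] p)" for n and b :: rat and p
      by (simp add: of_nat_poly) (simp flip: smult_minus_left)
    ultimately show ?thesis
      by (simp only: ballot_Suc distrib_left)
  qed
  then show ?thesis
    unfolding split by (simp add: sum_subtractf ballot_sum_def sum_distrib_left)
qed

text \<open>
  Both sides satisfy the same recurrence, which expresses the value at \<open>(d+2, k+1)\<close> by those at
  \<open>(d+2, k)\<close> and \<open>(d, k+2)\<close>. Hence strong induction on \<open>d\<close>, for all \<open>k\<close> at once, with an inner induction
  on \<open>k\<close>.
\<close>
lemma mid_sum_eq_ballot_sum: "mid_sum d k [:0, 1:] = ballot_sum d k"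
proof (induction d arbitrary: k rule: less_induct)
  case (less d)
  have base: "ballot_sum d 0 = S_mid d"
  proof -
    have "ballot_sum d 0 = (\<Sum>j\<le>d div 2. if j = 0 then S_mid d else 0)"
      unfolding ballot_sum_def by (intro sum.cong refl) (simp add: ballot_0_right one_pCons [symmetric])
    then show ?thesis
      by simp
  qed
  consider "d = 0" | "d = Suc 0" | e where "d = e + 2"
    by (metis One_nat_def add_2_eq_Suc' not0_implies_Suc)
  then show ?case
  proof cases
    case 3
    show ?thesis
    proof (induction k)
      case 0
      show ?case
        by (simp only: base mid_sum_0_eq_S_mid)
    next
      case (Suc k)
      have "mid_sum e (k + 2) [:0, 1:] = ballot_sum e (k + 2)"
        by (rule less.IH) (simp add: 3)
      then show ?case
        using Suc by (simp only: 3 mid_sum_rec ballot_sum_rec)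
    qed
  qed (simp_all add: ballot_sum_def one_pCons [symmetric])
qed

section \<open>Substituting \<open>\<varpi> = 2 + u\<close>\<close>

lemma bessel_coeff_times_choose:
  assumes "r \<le> d"
  shows "bessel_coeff (k + d) (k + r) * ((k + r) choose k) * 2 ^ r =
    bessel_coeff (k + d) k * mid_coeff d (2 * k + d) r"
proof -
  obtain s where d: "d = r + s"
    using assms le_Suc_ex by blast
  have "fact (2 * k + d + r) = (fact (2 * k + d) * of_nat (pochhammer (Suc (2 * k + d)) r) :: rat)"
    using pochhammer_product' [of "1 :: rat" "2 * k + d" r]
    by (simp add: pochhammer_fact pochhammer_of_nat [symmetric])
  moreover have "of_nat (bessel_coeff (k + d) (k + r)) =
      (fact (2 * k + d + r) / (fact s * fact (k + r) * 2 ^ (k + r)) :: rat)"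
  proof -
    have "k + d = k + r + s" "2 * k + d + r = 2 * (k + r) + s"
      by (simp_all add: d)
    then show ?thesis
      by (simp only: of_nat_bessel_coeff)
  qed
  moreover have "of_nat ((k + r) choose k) = (fact (k + r) / (fact k * fact r) :: rat)"
    by (simp add: binomial_fact)
  moreover have "of_nat (d choose r) = (fact d / (fact r * fact s) :: rat)"
    by (simp add: binomial_fact d)
  ultimately have "of_nat (bessel_coeff (k + d) (k + r) * ((k + r) choose k) * 2 ^ r) =
    (of_nat (bessel_coeff (k + d) k * mid_coeff d (2 * k + d) r) :: rat)"
    by (simp add: mid_coeff_def of_nat_bessel_coeff power_add)
  then show ?thesis
    unfolding of_nat_eq_iff .
qed

lemma sum_bessel_coeff_shift:
  fixes u z :: "'a :: comm_ring_1"
  shows "(\<Sum>i\<le>l. of_nat (bessel_coeff l i) * (u + 2) ^ i * even_prod 0 i l z) =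
    (\<Sum>k\<le>l. of_nat (bessel_coeff l k) * u ^ k * mid_sum (l - k) k z)"
proof -
  let ?t = "\<lambda>i k. of_nat (bessel_coeff l i * (i choose k) * 2 ^ (i - k)) * u ^ k * even_prod 0 i l z"
  have "(\<Sum>i\<le>l. of_nat (bessel_coeff l i) * (u + 2) ^ i * even_prod 0 i l z) = (\<Sum>i\<le>l. \<Sum>k\<le>i. ?t i k)"
    unfolding binomial_ring by (simp add: sum_distrib_left sum_distrib_right mult_ac)
  also have "\<dots> = (\<Sum>k\<le>l. \<Sum>r\<le>l - k. ?t (k + r) k)"
    unfolding sum.Sigma [OF finite_atMost ballI [OF finite_atMost]]
    by (rule sum.reindex_bij_witness [where j = "\<lambda>(i, k). (k, i - k)" and i = "\<lambda>(k, r). (k + r, k)"]) auto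
  also have "\<dots> = (\<Sum>k\<le>l. of_nat (bessel_coeff l k) * u ^ k * mid_sum (l - k) k z)"
  proof (rule sum.cong [OF refl])
    fix k assume "k \<in> {..l}"
    then obtain d where l: "l = k + d"
      using le_Suc_ex by auto
    have "?t (k + r) k = of_nat (bessel_coeff l k) * u ^ k *
        (of_nat (mid_coeff d (2 * k + d) r) * even_prod k r d z)" if "r \<le> d" for r
      using bessel_coeff_times_choose [OF that, of k] even_prod_shift [of 0 k r d z]
      by (simp add: l add_ac mult_ac flip: of_nat_mult)
    then show "(\<Sum>r\<le>l - k. ?t (k + r) k) = of_nat (bessel_coeff l k) * u ^ k * mid_sum (l - k) k z"
      by (simp add: l mid_sum_def sum_distrib_left)
  qed
  finally show ?thesis .
qed

text \<open>
  The prefactor \<open>(2k-1)!! binom(l+k, 2k)\<close> is the Bessel coefficient \<open>b\<^sub>l\<^sub>,\<^sub>k\<close>, so the expansion in powers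
  of \<open>\<varpi>\<close>, its re-expansion in \<open>u\<close> and the ballot form of \<^const>\<open>mid_sum\<close> combine to the formula.
\<close>
theorem theorem5p4:
  fixes l :: nat
  shows "P_num l = to_fract
    (\<Sum>k\<le>l. let d = l - k in
      smult ([:odd_dfact k * of_nat ((l + k) choose (2 * k)):] * u_var ^ k)
        (\<Sum>j\<le>d div 2.
          smult [:(-1) ^ j * (fact d / fact (d - 2 * j)) * ballot j k:] (S_mid (d - 2 * j))))"
proof -
  define Z :: "rat poly poly" where "Z = [:0, 1:]"
  have const_of_nat: "[:of_nat n:] = (of_nat n :: 'a :: comm_semiring_1 poly)" for n
    by (simp add: of_nat_poly)
  have "(\<Sum>i\<le>l. [:monom (of_nat (bessel_coeff l i)) i:] * (\<Prod>j\<in>{i<..l}. [:- of_nat (2 * j), 1:])) =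
      (\<Sum>i\<le>l. of_nat (bessel_coeff l i) * ([:u_var:] + 2) ^ i * even_prod 0 i l Z)"
  proof (rule sum.cong [OF refl])
    fix i
    have "[:- of_nat (2 * j), 1:] = Z - of_nat (2 * (0 + j))" for j
      by (simp add: Z_def of_nat_poly del: of_nat_mult)
    then have "(\<Prod>j\<in>{i<..l}. [:- of_nat (2 * j), 1:]) = even_prod 0 i l Z"
      unfolding even_prod_def by simp
    moreover have "[:monom (of_nat n) i:] = of_nat n * ([:u_var:] + 2) ^ i" for n
    proof -
      have "monom (of_nat n) i = of_nat n * ([:0, 1:] :: rat poly) ^ i"
        by (simp add: monom_altdef of_nat_poly)
      then have "[:monom (of_nat n) i:] = [:of_nat n:] * [:[:0, 1 :: rat:]:] ^ i"
        unfolding poly_const_pow by simp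
      moreover have "[:[:0, 1:]:] = [:u_var:] + (2 :: rat poly poly)"
        by (simp add: u_var_def numeral_poly)
      ultimately show ?thesis
        by (simp only: const_of_nat)
    qed
    ultimately show "[:monom (of_nat (bessel_coeff l i)) i:] * (\<Prod>j\<in>{i<..l}. [:- of_nat (2 * j), 1:]) =
        of_nat (bessel_coeff l i) * ([:u_var:] + 2) ^ i * even_prod 0 i l Z"
      by (simp only:)
  qed
  also have "\<dots> = (\<Sum>k\<le>l. of_nat (bessel_coeff l k) * [:u_var:] ^ k * ballot_sum (l - k) k)"
    unfolding sum_bessel_coeff_shift by (simp add: Z_def mid_sum_eq_ballot_sum)
  also have "\<dots> = (\<Sum>k\<le>l. smult ([:odd_dfact k * of_nat ((l + k) choose (2 * k)):] * u_var ^ k) (ballot_sum (l - k) k))"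
  proof (rule sum.cong [OF refl])
    fix k
    have "odd_dfact k * of_nat ((l + k) choose (2 * k)) = of_nat (bessel_coeff l k)"
      by (simp add: odd_dfact_def bessel_coeff_def)
    moreover have "of_nat n * [:u_var:] ^ k * p = smult ([:of_nat n:] * u_var ^ k) p" for n p
      by (simp add: poly_const_pow of_nat_poly)
    ultimately show "of_nat (bessel_coeff l k) * [:u_var:] ^ k * ballot_sum (l - k) k =
        smult ([:odd_dfact k * of_nat ((l + k) choose (2 * k)):] * u_var ^ k) (ballot_sum (l - k) k)"
      by (simp only:)
  qed
  finally show ?thesis
    unfolding P_num_eq Let_def ballot_sum_def by (rule arg_cong [where f = to_fract])
qed

end
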